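(* Consider any allocation process satisfying conditions $\mathcal{P}_1$ and $\mathcal{W}_1$ and let $C\ge1$ be any integer constant. Then there exists a constant $\varepsilon=\varepsilon(C)\in(0,\frac12)$, where $(4\varepsilon)^{-1}$ is an integer, such that for all sufficiently large $n$ and any round $t_0\ge0$, $$\Pr\Big[\Big|\Big\{t\in\Big[t_0,t_0+\frac{n}{4\varepsilon}\Big]:\delta^t\in[\varepsilon,1-\varepsilon]\Big\}\Big|\ge\varepsilon n\;\Big|\;\mathfrak{F}^{t_0},\ \Delta^{t_0}\le Cn\Big]\ge1-e^{-\varepsilon n},$$ where $t$ ranges over integers.
   Context: Allocation processes. For each $n$, balls are sequentially allocated into $n$ bins. $x^t\in\mathbb{Z}_{\ge0}^n$ is the load vector after $t$ allocations (round $t=0,1,2,\dots$), with $x^0=(0,\dots,0)$. In the $(t+1)$-th allocation exactly one bin is chosen and it receives one or more balls. $W^t=\sum_ix_i^t$ and $y_i^t=x_i^t-W^t/n$. $\mathfrak{F}^t$ is the filtration of the first $t$ allocations. At each round $t$ bins are relabelled so that $x_1^t\ge\dots\ge x_n^t$, and $p_i^t$ (which may depend on $\mathfrak F^t$) is the conditional probability, given $\mathfrak{F}^t$, that the bin chosen in the $(t+1)$-th allocation is the $i$-th heaviest. $B_+^t=\{i:y_i^t\ge0\}$, $B_-^t=[n]\setminus B_+^t$, $\delta^t=|B_+^t|/n$, and $\Delta^t=\sum_{i=1}^n|y_i^t|$. For vectors of equal length, $p\succeq q$ (equivalently $q\preceq p$) means $\sum_{i=1}^kp_i\ge\sum_{i=1}^kq_i$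 for every $k$. Conditions on an empty set of bins are vacuous. "Constant" means independent of $t$ and $n$; $\varepsilon$ may depend on $C$ and the constants of the process. Condition $\mathcal{P}_1$: there are an integer constant $k_1\ge1$ and a constant $k_2\in(0,1]$ such that for each round $t\ge0$: $\max_{i\in B_+^t}p_i^t\le k_1/n$ and $(p_1^t,\dots,p_{\delta^tn}^t)\preceq(\frac1n,\dots,\frac1n)$; and $\min_{i\in B_-^t}p_i^t\ge k_2/n$ and $(p_n^t,p_{n-1}^t,\dots,p_{\delta^tn+1}^t)\succeq(\frac1n,\dots,\frac1n)$. Condition $\mathcal{W}_1$: for each round $t\ge0$, when bin $i$ is chosen for allocation, $w_-$ balls are allocated to $i$ if $y_i^t<0$ and $w_+$ balls if $y_i^t\ge0$, where $1\le w_+\le w_-$ are constant integers. *)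

theory Defs
  imports "HOL-Probability.Probability"
begin

(* An allocation process on n bins, with bins and ranks numbered 1..n.
   chosen t and balls t are the bin and the number of balls of the (t+1)-th allocation.
   label t is the relabelling at round t: label t w i is the i-th heaviest bin.  As the order of
   equally loaded bins is not prescribed, the relabelling is part of the process. *)
record 'a alloc =
  sample :: "'a measure"
  chosen :: "nat \<Rightarrow> 'a \<Rightarrow> nat"
  balls :: "nat \<Rightarrow> 'a \<Rightarrow> nat"
  label :: "nat \<Rightarrow> 'a \<Rightarrow> nat \<Rightarrow> nat"

definition load :: "'a alloc \<Rightarrow> nat \<Rightarrow> 'a \<Rightarrow> nat \<Rightarrow> nat" where
  "load A t \<omega> j = (\<Sum>s<t. if chosen A s \<omega> = j then balls A s \<omega> else 0)"

definition history :: "'a alloc \<Rightarrow> nat \<Rightarrow> 'a \<Rightarrow> (nat \<times> nat) list" where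
  "history A t \<omega> = map (\<lambda>s. (chosen A s \<omega>, balls A s \<omega>)) [0..<t]"

definition filt :: "'a alloc \<Rightarrow> nat \<Rightarrow> 'a measure" where
  "filt A t = vimage_algebra (space (sample A)) (history A t) (count_space UNIV)"

definition allocation_process :: "nat \<Rightarrow> 'a alloc \<Rightarrow> bool" where
  "allocation_process n A \<longleftrightarrow>
     prob_space (sample A) \<and>
     (\<forall>t. chosen A t \<in> measurable (sample A) (count_space UNIV) \<and>
          balls A t \<in> measurable (sample A) (count_space UNIV) \<and>
          (\<forall>i\<in>{1..n}. (\<lambda>\<omega>. label A t \<omega> i) \<in> measurable (filt A t) (count_space UNIV))) \<and>
     (\<forall>t. \<forall>\<omega>\<in>space (sample A).
          chosen A t \<omega> \<in> {1..n} \<and> 1 \<le> balls A t \<omega> \<and>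
          bij_betw (label A t \<omega>) {1..n} {1..n} \<and>
          (\<forall>i\<in>{1..n}. \<forall>j\<in>{1..n}. i \<le> j \<longrightarrow>
             load A t \<omega> (label A t \<omega> j) \<le> load A t \<omega> (label A t \<omega> i)))"

definition total_load :: "nat \<Rightarrow> 'a alloc \<Rightarrow> nat \<Rightarrow> 'a \<Rightarrow> nat" where
  "total_load n A t \<omega> = (\<Sum>j=1..n. load A t \<omega> j)"

(* y with the persistent bin names; the y_i of the sorted vector is
   deviation n A t w (label A t w i). *)
definition deviation :: "nat \<Rightarrow> 'a alloc \<Rightarrow> nat \<Rightarrow> 'a \<Rightarrow> nat \<Rightarrow> real" where
  "deviation n A t \<omega> j = real (load A t \<omega> j) - real (total_load n A t \<omega>) / real n"

definition Bplus :: "nat \<Rightarrow> 'a alloc \<Rightarrow> nat \<Rightarrow> 'a \<Rightarrow> nat set" where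
  "Bplus n A t \<omega> = {i\<in>{1..n}. 0 \<le> deviation n A t \<omega> (label A t \<omega> i)}"

definition Bminus :: "nat \<Rightarrow> 'a alloc \<Rightarrow> nat \<Rightarrow> 'a \<Rightarrow> nat set" where
  "Bminus n A t \<omega> = {1..n} - Bplus n A t \<omega>"

definition delta :: "nat \<Rightarrow> 'a alloc \<Rightarrow> nat \<Rightarrow> 'a \<Rightarrow> real" where
  "delta n A t \<omega> = real (card (Bplus n A t \<omega>)) / real n"

definition Delta :: "nat \<Rightarrow> 'a alloc \<Rightarrow> nat \<Rightarrow> 'a \<Rightarrow> real" where
  "Delta n A t \<omega> = (\<Sum>i=1..n. \<bar>deviation n A t \<omega> (label A t \<omega> i)\<bar>)"

definition cprob :: "'a alloc \<Rightarrow> nat \<Rightarrow> 'a set \<Rightarrow> 'a \<Rightarrow> real" where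
  "cprob A t E = real_cond_exp (sample A) (filt A t) (indicator E)"

definition pvec :: "'a alloc \<Rightarrow> nat \<Rightarrow> 'a \<Rightarrow> nat \<Rightarrow> real" where
  "pvec A t \<omega> i = cprob A t {\<omega>'\<in>space (sample A). chosen A t \<omega>' = label A t \<omega>' i} \<omega>"

(* Prefix sums are compared in the given order: no sorting and no equality of the totals. *)
definition majorizes :: "real list \<Rightarrow> real list \<Rightarrow> bool" where
  "majorizes p q \<longleftrightarrow> length p = length q \<and>
     (\<forall>k\<le>length p. sum_list (take k q) \<le> sum_list (take k p))"

(* card (Bplus n A t w) is the integer delta * n.  "Almost everywhere" is needed because
   conditional probabilities are only determined up to null sets. *)
definition cond_P1 :: "nat \<Rightarrow> real \<Rightarrow> nat \<Rightarrow> 'a alloc \<Rightarrow> bool" where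
  "cond_P1 k1 k2 n A \<longleftrightarrow> (\<forall>t. AE \<omega> in sample A.
     let p = pvec A t \<omega>; b = card (Bplus n A t \<omega>) in
       (\<forall>i\<in>Bplus n A t \<omega>. p i \<le> real k1 / real n) \<and>
       majorizes (replicate b (1 / real n)) (map p [1..<b+1]) \<and>
       (\<forall>i\<in>Bminus n A t \<omega>. k2 / real n \<le> p i) \<and>
       majorizes (map p (rev [b+1..<n+1])) (replicate (n - b) (1 / real n)))"

definition cond_W1 :: "nat \<Rightarrow> nat \<Rightarrow> nat \<Rightarrow> 'a alloc \<Rightarrow> bool" where
  "cond_W1 wminus wplus n A \<longleftrightarrow> (\<forall>t. \<forall>\<omega>\<in>space (sample A).
     balls A t \<omega> = (if deviation n A t \<omega> (chosen A t \<omega>) < 0 then wminus else wplus))"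

end

(* As long as almost all bins are overloaded, the mean passes within O(n) rounds a level shared by
   linearly many bins, and since overloaded bins are hit at rate at most k1/n, linearly many of them stay
   behind and become underloaded. As long as almost all bins are underloaded, a truncated exponential
   potential grows by a large factor within n rounds, as each of them is hit at rate at least k2/n; this
   is impossible. Both statements hold up to exponentially small probability by an exponential
   supermartingale, with bounds that do not depend on epsilon. So within O(n) rounds delta falls to at
   most 1 - 2 epsilon, and from any low state it climbs to 2 epsilon within n rounds; since |B_+| grows
   by at most one per round, there are epsilon n balanced rounds on the way. *)
theory Submission
  imports Defs "HOL-Real_Asymp.Real_Asymp"
begin

text \<open>The window lengthens as \<epsilon> shrinks, but the bound used on the spread, 2
  \<open>wminus\<close> more per round, would degrade to order n/\<epsilon> over all of it. So the
  estimates are confined to the first (2C + 2)n rounds, where the spread stays below a multiple of n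
  fixed by C and \<open>wminus\<close>; \<epsilon> is chosen last, as 1/(4K) with K above the
  thresholds set by the estimates. The climb from a low state begins at a random round. Instead of a
  stopping time, its failure is bounded from each of (2C + 1)n + 1 deterministic rounds; proving the
  rate 2\<epsilon> leaves room for the linear factor of the union bound. Both supermartingales have
  the form exp(const - \<theta>_r X), where X is a count or a potential and r is the number of
  rounds left. Letting \<theta>_r vary geometrically in r absorbs the multiplicative drift of X.
  Each \<sigma>-algebra of the filtration has countably many atoms, the fibres of the history, so
  statements on conditional probabilities become inequalities between probabilities of
  atoms.\<close>

section \<open>Load vectors and the effect of one allocation\<close>

definition mean :: "nat \<Rightarrow> (nat \<Rightarrow> nat) \<Rightarrow> real" where
  "mean n x = real (\<Sum>j=1..n. x j) / real n"

definition over :: "nat \<Rightarrow> (nat \<Rightarrow> nat) \<Rightarrow> nat set" where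
  "over n x = {j\<in>{1..n}. mean n x \<le> real (x j)}"

definition spread :: "nat \<Rightarrow> (nat \<Rightarrow> nat) \<Rightarrow> real" where
  "spread n x = (\<Sum>j=1..n. \<bar>real (x j) - mean n x\<bar>)"

definition put :: "nat \<Rightarrow> nat \<Rightarrow> nat \<Rightarrow> (nat \<Rightarrow> nat) \<Rightarrow> nat \<Rightarrow> nat \<Rightarrow> nat" where
  "put n a b x i = x(i := x i + (if real (x i) < mean n x then a else b))"

text \<open>Newest allocation first. The numbers of balls are omitted, as they are determined by the chosen
  bins.\<close>

primrec hist :: "'a alloc \<Rightarrow> nat \<Rightarrow> 'a \<Rightarrow> nat list" where
  "hist A 0 \<omega> = []"
| "hist A (Suc t) \<omega> = chosen A t \<omega> # hist A t \<omega>"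

primrec loads :: "nat \<Rightarrow> nat \<Rightarrow> nat \<Rightarrow> nat list \<Rightarrow> nat \<Rightarrow> nat" where
  "loads n a b [] = (\<lambda>_. 0)"
| "loads n a b (i # h) = put n a b (loads n a b h) i"

lemma length_hist [simp]: "length (hist A t \<omega>) = t"
  by (induction t) auto

lemma finite_over [simp]: "finite (over n x)"
  by (simp add: over_def)

lemma sum_put:
  assumes "i \<in> {1..n}"
  shows "(\<Sum>j=1..n. put n a b x i j) =
    (\<Sum>j=1..n. x j) + (if real (x i) < mean n x then a else b)"
proof -
  have "(\<Sum>j=1..n. put n a b x i j) =
      (\<Sum>j=1..n. x j + (if j = i then (if real (x i) < mean n x then a else b) else 0))"
    by (intro sum.cong) (auto simp: put_def)
  then show ?thesis
    using assms by (simp add: sum.distrib)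
qed

lemma put_ge: "x j \<le> put n a b x i j"
  by (simp add: put_def)

lemma mean_mono_put: "mean n x \<le> mean n (put n a b x i)"
  unfolding mean_def
  by (intro divide_right_mono of_nat_mono sum_mono put_ge) auto

text \<open>Only bin \<open>i\<close> can newly join: the mean never falls, so an untouched bin can
  at most drop out. Many bins may drop out at once, so there is no matching lower bound.\<close>

lemma card_over_put: "card (over n (put n a b x i)) \<le> card (over n x) + 1"
proof -
  have "over n (put n a b x i) \<subseteq> insert i (over n x)"
  proof
    fix j assume j: "j \<in> over n (put n a b x i)"
    show "j \<in> insert i (over n x)"
    proof (cases "j = i")
      case False
      then have "put n a b x i j = x j" by (simp add: put_def)
      then show ?thesis
        using j mean_mono_put[of n x a b i] by (auto simp: over_def)
    qed simp
  qed
  then have "card (over n (put n a b x i)) \<le> card (insert i (over n x))"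
    by (intro card_mono) auto
  also have "\<dots> \<le> card (over n x) + 1"
    by (simp add: card_insert_if)
  finally show ?thesis .
qed

text \<open>The new balls cost at most their number at bin \<open>i\<close>, and the resulting shift
  of the mean costs the same number again, summed over all bins.\<close>

lemma spread_put:
  assumes i: "i \<in> {1..n}" and ab: "b \<le> a"
  shows "spread n (put n a b x i) \<le> spread n x + 2 * real a"
proof -
  define c where "c = (if real (x i) < mean n x then a else b)"
  have c: "c \<le> a" using ab by (simp add: c_def)
  have n: "n > 0" using i by auto
  have m: "mean n (put n a b x i) = mean n x + real c / real n"
    unfolding mean_def using sum_put[OF i, of a b x] by (simp add: c_def mean_def add_divide_distrib)
  have "spread n (put n a b x i) \<le>
      (\<Sum>j=1..n. \<bar>real (x j) - mean n x\<bar> + ((if j = i then real c else 0) + real c / real n))"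
    unfolding spread_def m
  proof (rule sum_mono)
    fix j
    have shift: "\<bar>p - (m + d)\<bar> \<le> \<bar>q - m\<bar> + (e + d)" if "0 \<le> e" "0 \<le> d" "p = q + e"
      for p q m d e :: real
      using that by linarith
    show "\<bar>real (put n a b x i j) - (mean n x + real c / real n)\<bar>
        \<le> \<bar>real (x j) - mean n x\<bar> + ((if j = i then real c else 0) + real c / real n)"
      by (rule shift) (auto simp: put_def c_def)
  qed
  also have "\<dots> = spread n x + 2 * real c"
    using i n by (simp add: spread_def sum.distrib)
  also have "\<dots> \<le> spread n x + 2 * real a" using c by simp
  finally show ?thesis .
qed

text \<open>Markov's inequality at twice the average deviation.\<close>

lemma card_near_mean:
  assumes n: "n > 0" and C: "C > 0" and s: "spread n x \<le> C * real n"
  shows "real n / 2 \<le> real (card {j\<in>{1..n}. \<bar>real (x j) - mean n x\<bar> < 2 * C})"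
proof -
  let ?N = "{j\<in>{1..n}. \<bar>real (x j) - mean n x\<bar> < 2 * C}"
  let ?F = "{1..n} - ?N"
  have "real (card ?F) * (2 * C) \<le> (\<Sum>j\<in>?F. \<bar>real (x j) - mean n x\<bar>)"
    by (rule sum_bounded_below[where K = "2 * C", simplified]) auto
  also have "\<dots> \<le> spread n x"
    unfolding spread_def by (intro sum_mono2) auto
  finally have "real (card ?F) * (2 * C) \<le> C * real n" using s by simp
  then have "C * (2 * real (card ?F)) \<le> C * real n" by (simp add: mult_ac)
  then have "2 * real (card ?F) \<le> real n" using C by (simp only: mult_le_cancel_left_pos)
  moreover have "card ?F + card ?N = n"
  proof -
    have "card ({1..n} - ?N) = card {1..n} - card ?N"
      by (rule card_Diff_subset) auto
    moreover have "card ?N \<le> card {1..n}" by (rule card_mono) auto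
    ultimately show ?thesis by simp
  qed
  ultimately show ?thesis by linarith
qed

section \<open>Atoms of the histories and the conditional probabilities on them\<close>

locale allocation =
  fixes n k1 wminus wplus :: nat and k2 :: real and A :: "'a alloc"
  assumes n_pos: "1 \<le> n" and k1_pos: "1 \<le> k1" and k2_pos: "0 < k2" and k2_le: "k2 \<le> 1"
    and wplus_pos: "1 \<le> wplus" and wplus_le: "wplus \<le> wminus"
    and process: "allocation_process n A"
    and P1: "cond_P1 k1 k2 n A" and W1: "cond_W1 wminus wplus n A"
begin

sublocale prob_space "sample A"
  using process by (simp add: allocation_process_def)

abbreviation "ld \<equiv> loads n wminus wplus"
abbreviation "step \<equiv> put n wminus wplus"

definition atom :: "nat list \<Rightarrow> 'a set" where
  "atom h = {\<omega>\<in>space (sample A). hist A (length h) \<omega> = h}"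

lemma chosen_in: "\<omega> \<in> space (sample A) \<Longrightarrow> chosen A t \<omega> \<in> {1..n}"
  using process unfolding allocation_process_def by blast

lemma chosen_measurable: "chosen A t \<in> measurable (sample A) (count_space UNIV)"
  using process unfolding allocation_process_def by blast

lemma load_eq: "\<omega> \<in> space (sample A) \<Longrightarrow> load A t \<omega> = ld (hist A t \<omega>)"
proof (induction t)
  case 0
  then show ?case by (auto simp: load_def)
next
  case (Suc t)
  let ?i = "chosen A t \<omega>"
  have m: "mean n (ld (hist A t \<omega>)) = real (total_load n A t \<omega>) / real n"
    using Suc by (simp add: mean_def total_load_def)
  have "balls A t \<omega> = (if deviation n A t \<omega> ?i < 0 then wminus else wplus)"
    using W1 Suc.prems by (simp add: cond_W1_def)
  then have b: "balls A t \<omega> = (if real (ld (hist A t \<omega>) ?i) < mean n (ld (hist A t \<omega>)) then wminus else wplus)"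
    using Suc m by (simp add: deviation_def)
  have "load A (Suc t) \<omega> j = load A t \<omega> j + (if ?i = j then balls A t \<omega> else 0)" for j
    by (simp add: load_def)
  then show ?case
    using Suc b by (auto simp: put_def fun_eq_iff)
qed

lemma deviation_eq:
  "\<omega> \<in> space (sample A) \<Longrightarrow>
    deviation n A t \<omega> j = real (ld (hist A t \<omega>) j) - mean n (ld (hist A t \<omega>))"
  by (simp add: deviation_def total_load_def load_eq mean_def)

lemma balls_eq:
  "\<omega> \<in> space (sample A) \<Longrightarrow> balls A t \<omega> =
    (if real (ld (hist A t \<omega>) (chosen A t \<omega>)) < mean n (ld (hist A t \<omega>)) then wminus else wplus)"
  using W1 by (auto simp: cond_W1_def deviation_eq)

text \<open>The filtration is generated by \<open>history\<close>, while the inductions run over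
  \<open>hist\<close>; equal fibres make the sets \<open>atom h\<close> the atoms of
  \<open>filt\<close>.\<close>

lemma history_eq_iff:
  assumes "\<omega> \<in> space (sample A)" "\<omega>' \<in> space (sample A)"
  shows "history A t \<omega> = history A t \<omega>' \<longleftrightarrow> hist A t \<omega> = hist A t \<omega>'"
proof (induction t)
  case 0
  then show ?case by (simp add: history_def)
next
  case (Suc t)
  have *: "history A (Suc t) u = history A t u @ [(chosen A t u, balls A t u)]" for u
    by (simp add: history_def)
  show ?case
    using Suc balls_eq[OF assms(1), of t] balls_eq[OF assms(2), of t] by (auto simp: *)
qed

lemma hist_measurable: "hist A t \<in> measurable (sample A) (count_space UNIV)"
proof -
  have "hist A t -` {h} \<inter> space (sample A) \<in> events" for h
  proof (induction t arbitrary: h)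
    case 0
    then show ?case by (cases h) auto
  next
    case (Suc t)
    show ?case
    proof (cases h)
      case Nil
      then have "hist A (Suc t) -` {h} \<inter> space (sample A) = {}" by auto
      then show ?thesis by (simp only: sets.empty_sets)
    next
      case (Cons i g)
      have "chosen A t -` {i} \<inter> space (sample A) \<in> events"
        using chosen_measurable by (rule measurable_sets) simp
      with Suc[of g] have "(chosen A t -` {i} \<inter> space (sample A)) \<inter>
          (hist A t -` {g} \<inter> space (sample A)) \<in> events" by (rule sets.Int[rotated])
      also have "(chosen A t -` {i} \<inter> space (sample A)) \<inter>
          (hist A t -` {g} \<inter> space (sample A)) = hist A (Suc t) -` {h} \<inter> space (sample A)"
        using Cons by auto
      finally show ?thesis .
    qed
  qed
  then show ?thesis
    by (subst measurable_count_space_eq2_countable) auto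
qed

lemma events_hist: "{\<omega>\<in>space (sample A). Q (hist A t \<omega>)} \<in> events"
proof -
  have "hist A t -` Collect Q \<inter> space (sample A) \<in> events"
    by (rule measurable_sets[OF hist_measurable]) simp
  then show ?thesis by (simp add: vimage_def Int_def conj_commute)
qed

lemma atom_events: "atom h \<in> events"
  unfolding atom_def by (rule events_hist)

lemma history_measurable: "history A t \<in> measurable (sample A) (count_space UNIV)"
proof -
  have "history A t -` {h} \<inter> space (sample A) \<in> events" for h
  proof (cases "\<exists>\<omega>\<in>space (sample A). history A t \<omega> = h")
    case True
    then obtain \<omega> where w: "\<omega> \<in> space (sample A)" "history A t \<omega> = h" by blast
    then have "history A t -` {h} \<inter> space (sample A) = atom (hist A t \<omega>)"
      using history_eq_iff by (auto simp: atom_def)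
    then show ?thesis using atom_events by simp
  next
    case False
    then have "history A t -` {h} \<inter> space (sample A) = {}" by auto
    then show ?thesis by simp
  qed
  then show ?thesis
    by (subst measurable_count_space_eq2_countable) auto
qed

lemma subalgebra_filt: "subalgebra (sample A) (filt A t)"
proof -
  have "sets (filt A t) \<subseteq> events"
    unfolding filt_def
    by (subst sets_vimage_algebra2) (auto intro: measurable_sets[OF history_measurable])
  then show ?thesis by (simp add: subalgebra_def filt_def)
qed

text \<open>A set of \<open>filt A t\<close> is a union of fibres of the history, so a measurable
  function cannot separate two points of one fibre. This holds at every point, not just almost
  everywhere.\<close>

lemma filt_const:
  assumes f: "f \<in> measurable (filt A t) N" and N: "{f \<omega>} \<in> sets N"
    and w: "\<omega> \<in> space (sample A)" "\<omega>' \<in> space (sample A)" "hist A t \<omega>' = hist A t \<omega>"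
  shows "f \<omega>' = f \<omega>"
proof -
  have "f -` {f \<omega>} \<inter> space (filt A t) \<in> sets (filt A t)"
    using f N by (rule measurable_sets)
  then obtain S where S: "f -` {f \<omega>} \<inter> space (sample A) = history A t -` S \<inter> space (sample A)"
    by (auto simp: filt_def sets_vimage_algebra2)
  have "\<omega> \<in> f -` {f \<omega>} \<inter> space (sample A)" using w by simp
  then have "history A t \<omega> \<in> S" using S by auto
  then have "history A t \<omega>' \<in> S" using history_eq_iff[OF w(2,1), of t] w(3) by simp
  then have "\<omega>' \<in> f -` {f \<omega>} \<inter> space (sample A)" unfolding S using w by simp
  then show ?thesis by simp
qed

lemma cprob_const:
  assumes "\<omega> \<in> space (sample A)" "\<omega>' \<in> space (sample A)" "hist A t \<omega>' = hist A t \<omega>"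
  shows "cprob A t E \<omega>' = cprob A t E \<omega>"
  unfolding cprob_def
  by (rule filt_const[OF borel_measurable_cond_exp _ assms]) simp

text \<open>On the atom the conditional probability is a constant, so its defining integral identity
  over the atom becomes a product.\<close>

lemma cprob_atom:
  assumes E: "E \<in> events" and w: "\<omega> \<in> space (sample A)"
  shows "cprob A t E \<omega> * prob (atom (hist A t \<omega>)) = prob (E \<inter> atom (hist A t \<omega>))"
proof -
  let ?a = "atom (hist A t \<omega>)"
  interpret F: finite_measure_subalgebra "sample A" "filt A t"
    using subalgebra_filt by unfold_locales
  have aF: "?a \<in> sets (filt A t)"
  proof -
    have "?a = history A t -` {history A t \<omega>} \<inter> space (sample A)"
      using w history_eq_iff by (auto simp: atom_def)
    then show ?thesis unfolding filt_def by (auto intro: in_vimage_algebra)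
  qed
  have iE: "integrable (sample A) (indicat_real E)"
    using E by (intro integrable_real_indicator) (simp_all add: emeasure_eq_measure)
  have "prob (E \<inter> ?a) = (\<integral>x\<in>?a. indicator E x \<partial>sample A)"
    using E atom_events[of "hist A t \<omega>"]
    by (simp add: set_lebesgue_integral_def indicator_inter_arith[symmetric] Int_commute)
  also have "\<dots> = (\<integral>x\<in>?a. cprob A t E x \<partial>sample A)"
    unfolding cprob_def by (rule F.real_cond_exp_intA[OF iE aF])
  also have "\<dots> = (\<integral>x\<in>?a. cprob A t E \<omega> \<partial>sample A)"
  proof (intro set_lebesgue_integral_cong atom_events allI impI)
    fix x assume "x \<in> ?a"
    then have "x \<in> space (sample A)" "hist A t x = hist A t \<omega>" by (auto simp: atom_def)
    then show "cprob A t E x = cprob A t E \<omega>" by (rule cprob_const[OF w])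
  qed
  also have "\<dots> = cprob A t E \<omega> * prob ?a"
    using atom_events by (simp add: set_integral_const)
  finally show ?thesis by simp
qed

text \<open>There are countably many lists, so the atoms of probability zero together form a null
  set.\<close>

lemma AE_atom_pos: "AE \<omega> in sample A. prob (atom (hist A t \<omega>)) > 0"
proof -
  have "AE \<omega> in sample A. prob (atom h) = 0 \<longrightarrow> \<omega> \<notin> atom h" for h
    using AE_not_in[of "atom h" "sample A"] atom_events[of h]
    by (cases "prob (atom h) = 0") (auto simp: null_sets_def emeasure_eq_measure)
  then have "AE \<omega> in sample A. \<forall>h::nat list. prob (atom h) = 0 \<longrightarrow> \<omega> \<notin> atom h"
    by (simp add: AE_all_countable)
  then show ?thesis
    using AE_space
  proof eventually_elim
    case (elim \<omega>)
    then have "\<omega> \<in> atom (hist A t \<omega>)" by (simp add: atom_def)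
    with elim have "prob (atom (hist A t \<omega>)) \<noteq> 0" by blast
    then show ?case using measure_nonneg[of "sample A" "atom (hist A t \<omega>)"] by linarith
  qed
qed

lemma atom_Cons_subset: "atom (i # h) \<subseteq> atom h"
  by (auto simp: atom_def)

lemma prob_atom_split:
  assumes "X \<in> events"
  shows "prob (atom h \<inter> X) = (\<Sum>i\<in>{1..n}. prob (atom (i # h) \<inter> X))"
proof -
  have "atom h \<inter> X = (\<Union>i\<in>{1..n}. atom (i # h) \<inter> X)"
    using chosen_in by (auto simp: atom_def)
  moreover have "disjoint_family_on (\<lambda>i. atom (i # h) \<inter> X) {1..n}"
    by (auto simp: disjoint_family_on_def atom_def)
  ultimately show ?thesis
    using assms atom_events
    by (simp only:) (rule finite_measure_finite_Union, auto)
qed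

lemma label_bij: "\<omega> \<in> space (sample A) \<Longrightarrow> bij_betw (label A t \<omega>) {1..n} {1..n}"
  using process unfolding allocation_process_def by blast

text \<open>The relabelling is measurable for the filtration, hence fixed on the atom; there,
  choosing rank \<open>i\<close> means choosing one fixed bin. This turns bounds on ranks into
  bounds on bin names.\<close>

lemma pvec_atom:
  assumes w: "\<omega> \<in> atom h" and i: "i \<in> {1..n}"
  shows "pvec A (length h) \<omega> i * prob (atom h) = prob (atom (label A (length h) \<omega> i # h))"
proof -
  let ?t = "length h"
  let ?E = "{\<omega>'\<in>space (sample A). chosen A ?t \<omega>' = label A ?t \<omega>' i}"
  have ws: "\<omega> \<in> space (sample A)" and h: "hist A ?t \<omega> = h" using w by (auto simp: atom_def)
  have lm: "(\<lambda>\<omega>. label A ?t \<omega> i) \<in> measurable (filt A ?t) (count_space UNIV)"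
    using process i unfolding allocation_process_def by blast
  have lm': "(\<lambda>\<omega>. label A ?t \<omega> i) \<in> measurable (sample A) (count_space UNIV)"
    using measurable_from_subalg[OF subalgebra_filt lm] .
  have E: "?E \<in> events"
  proof -
    have "(\<lambda>\<omega>. (chosen A ?t \<omega>, label A ?t \<omega> i)) \<in> measurable (sample A) (count_space UNIV \<Otimes>\<^sub>M count_space UNIV)"
      using chosen_measurable[of ?t] lm' by (rule measurable_Pair)
    then have "(\<lambda>\<omega>. (chosen A ?t \<omega>, label A ?t \<omega> i)) \<in> measurable (sample A) (count_space UNIV)"
      by (simp add: pair_measure_countable)
    from measurable_sets[OF this, of "{(x, y). x = y}"]
    show ?thesis by (simp add: vimage_def Int_def conj_commute)
  qed
  have "label A ?t \<omega>' i = label A ?t \<omega> i" if "\<omega>' \<in> atom h" for \<omega>'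
    using that ws h by (intro filt_const[OF lm]) (auto simp: atom_def)
  then have "?E \<inter> atom h = atom (label A ?t \<omega> i # h)"
    by (auto simp: atom_def)
  then show ?thesis
    using cprob_atom[OF E ws, of ?t] h by (simp add: pvec_def)
qed

lemma prob_atom_Cons:
  assumes j: "j \<in> {1..n}"
  shows "mean n (ld h) \<le> real (ld h j) \<Longrightarrow> prob (atom (j # h)) \<le> real k1 / real n * prob (atom h)"
    and "real (ld h j) < mean n (ld h) \<Longrightarrow> k2 / real n * prob (atom h) \<le> prob (atom (j # h))"
proof -
  let ?t = "length h"
  have "(mean n (ld h) \<le> real (ld h j) \<longrightarrow> prob (atom (j # h)) \<le> real k1 / real n * prob (atom h)) \<and>
        (real (ld h j) < mean n (ld h) \<longrightarrow> k2 / real n * prob (atom h) \<le> prob (atom (j # h)))"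
  proof (cases "prob (atom h) = 0")
    case True
    have "prob (atom (j # h)) \<le> prob (atom h)"
      using atom_Cons_subset atom_events by (intro finite_measure_mono) auto
    then show ?thesis using True by (simp add: antisym)
  next
    case False
    have "AE \<omega> in sample A. (\<forall>i\<in>Bplus n A ?t \<omega>. pvec A ?t \<omega> i \<le> real k1 / real n) \<and>
        (\<forall>i\<in>Bminus n A ?t \<omega>. k2 / real n \<le> pvec A ?t \<omega> i)"
      using P1 unfolding cond_P1_def Let_def by (auto elim!: allE[of _ ?t] eventually_mono)
    \<comment> \<open>The atom is not null, so the almost sure bounds hold at one of its points;
      \<open>pvec_atom\<close> carries them over to the probabilities of atoms.\<close>
    moreover have "\<not> (AE \<omega> in sample A. \<omega> \<notin> atom h)"
      using False atom_events[of h] by (subst AE_iff_measurable[of "atom h"])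
        (auto simp: emeasure_eq_measure dest: sets.sets_into_space)
    ultimately obtain \<omega> where w: "\<omega> \<in> atom h"
      and p: "\<forall>i\<in>Bplus n A ?t \<omega>. pvec A ?t \<omega> i \<le> real k1 / real n"
        "\<forall>i\<in>Bminus n A ?t \<omega>. k2 / real n \<le> pvec A ?t \<omega> i"
      by (smt (verit, best) eventually_mono)
    have ws: "\<omega> \<in> space (sample A)" and h: "hist A ?t \<omega> = h" using w by (auto simp: atom_def)
    obtain i where i: "i \<in> {1..n}" "label A ?t \<omega> i = j"
      using bij_betw_imp_surj_on[OF label_bij[OF ws, of ?t]] j by (metis imageE)
    have d: "deviation n A ?t \<omega> (label A ?t \<omega> i) = real (ld h j) - mean n (ld h)"
      using deviation_eq[OF ws] h i by simp
    have e: "pvec A ?t \<omega> i * prob (atom h) = prob (atom (j # h))"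
      using pvec_atom[OF w i(1)] i(2) by simp
    have "mean n (ld h) \<le> real (ld h j) \<Longrightarrow> pvec A ?t \<omega> i \<le> real k1 / real n"
      using p(1) i(1) d by (auto simp: Bplus_def)
    moreover have "real (ld h j) < mean n (ld h) \<Longrightarrow> k2 / real n \<le> pvec A ?t \<omega> i"
      using p(2) i(1) d by (auto simp: Bplus_def Bminus_def)
    ultimately show ?thesis
      unfolding e[symmetric] by (blast intro: mult_right_mono measure_nonneg)
  qed
  then show "mean n (ld h) \<le> real (ld h j) \<Longrightarrow> prob (atom (j # h)) \<le> real k1 / real n * prob (atom h)"
    and "real (ld h j) < mean n (ld h) \<Longrightarrow> k2 / real n * prob (atom h) \<le> prob (atom (j # h))"
    by blast+
qed

lemma card_Bplus:
  assumes "\<omega> \<in> space (sample A)"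
  shows "card (Bplus n A t \<omega>) = card (over n (ld (hist A t \<omega>)))"
proof -
  note b = label_bij[OF assms, of t]
  have "bij_betw (label A t \<omega>) (Bplus n A t \<omega>) (over n (ld (hist A t \<omega>)))"
  proof (rule bij_betw_subset[OF b])
    show "Bplus n A t \<omega> \<subseteq> {1..n}" by (auto simp: Bplus_def)
    show "label A t \<omega> ` Bplus n A t \<omega> = over n (ld (hist A t \<omega>))"
    proof -
      have "{j\<in>label A t \<omega> ` {1..n}. 0 \<le> deviation n A t \<omega> j} = over n (ld (hist A t \<omega>))"
        unfolding bij_betw_imp_surj_on[OF b] using deviation_eq[OF assms] by (auto simp: over_def)
      moreover have "label A t \<omega> ` Bplus n A t \<omega> = {j\<in>label A t \<omega> ` {1..n}. 0 \<le> deviation n A t \<omega> j}"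
        unfolding Bplus_def by blast
      ultimately show ?thesis by simp
    qed
  qed
  then show ?thesis by (rule bij_betw_same_card)
qed

lemma Delta_eq:
  assumes "\<omega> \<in> space (sample A)"
  shows "Delta n A t \<omega> = spread n (ld (hist A t \<omega>))"
  unfolding Delta_def spread_def deviation_eq[OF assms]
  by (rule sum.reindex_bij_betw[OF label_bij[OF assms]])

end

section \<open>One-step estimates for the level count and the potential\<close>

text \<open>Stands for the possible conditional laws of the next bin at loads \<open>x\<close>, so
  that the one-step estimates can be stated without the process.\<close>

definition admissible :: "nat \<Rightarrow> nat \<Rightarrow> real \<Rightarrow> (nat \<Rightarrow> nat) \<Rightarrow> (nat \<Rightarrow> real) \<Rightarrow> bool" where
  "admissible n k1 k2 x q \<longleftrightarrow> (\<forall>i\<in>{1..n}. 0 \<le> q i) \<and> (\<Sum>i=1..n. q i) = 1 \<and>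
     (\<forall>i\<in>over n x. q i \<le> real k1 / real n) \<and> (\<forall>i\<in>{1..n} - over n x. k2 / real n \<le> q i)"

lemma exp_le_2:
  fixes z :: real assumes "0 \<le> z" "z \<le> 1" shows "exp z \<le> 1 + 2 * z"
proof -
  have "exp z \<le> 1 + z + z\<^sup>2" using exp_bound[OF assms] .
  moreover have "z\<^sup>2 \<le> z" using assms by (simp add: power2_eq_square mult_left_le_one_le)
  ultimately show ?thesis by linarith
qed

lemma exp_minus_le_half:
  fixes z :: real assumes "0 \<le> z" "z \<le> 1" shows "exp (- z) \<le> 1 - z / 2"
proof -
  have "exp (- z) \<le> 1 / (1 + z)"
    using exp_ge_add_one_self[of z] assms by (simp add: exp_minus field_simps)
  also have "\<dots> \<le> 1 - z / 2"
  proof -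
    have "z * z \<le> z * 1" using assms by (intro mult_left_mono) auto
    then show ?thesis using assms by (simp add: field_simps)
  qed
  finally show ?thesis .
qed

definition level :: "nat \<Rightarrow> nat \<Rightarrow> (nat \<Rightarrow> nat) \<Rightarrow> nat" where
  "level n v x = card {j\<in>{1..n}. x j = v}"

text \<open>With the mean at most \<open>v\<close>, the bins at level \<open>v\<close> are
  overloaded, so one of them is hit with probability at most \<open>k1 / n\<close> times their
  number. Such a hit loses at most one of them, and other hits lose none. The factor 2 comes from
  \<open>exp_le_2\<close>.\<close>

lemma level_step:
  fixes \<theta> :: real
  assumes n: "1 \<le> n" and q: "admissible n k1 k2 x q" and v: "mean n x \<le> real v"
    and \<theta>: "0 \<le> \<theta>" "\<theta> \<le> 1"
  shows "(\<Sum>i=1..n. q i * exp (- \<theta> * real (level n v (put n a b x i))))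
    \<le> exp (- \<theta> * real (level n v x) * (1 - 2 * real k1 / real n))"
proof -
  let ?L = "{j\<in>{1..n}. x j = v}"
  let ?e = "exp (- \<theta> * real (level n v x))"
  have Lover: "?L \<subseteq> over n x" using v by (auto simp: over_def)
  have one: "exp (- \<theta> * real (level n v (put n a b x i))) \<le> ?e * (1 + (if i \<in> ?L then 2 * \<theta> else 0))"
    if i: "i \<in> {1..n}" for i
  proof (cases "i \<in> ?L")
    case True
    have "?L - {i} \<subseteq> {j\<in>{1..n}. put n a b x i j = v}" by (auto simp: put_def)
    then have "card (?L - {i}) \<le> level n v (put n a b x i)"
      unfolding level_def by (intro card_mono) auto
    then have "level n v x \<le> level n v (put n a b x i) + 1"
      using True by (simp add: level_def)
    then have "real (level n v x) \<le> real (level n v (put n a b x i)) + 1" by linarith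
    from mult_left_mono[OF this \<theta>(1)]
    have "exp (- \<theta> * real (level n v (put n a b x i))) \<le> exp (- \<theta> * real (level n v x) + \<theta>)"
      by (simp add: algebra_simps)
    also have "\<dots> = ?e * exp \<theta>" by (rule exp_add)
    also have "\<dots> \<le> ?e * (1 + 2 * \<theta>)"
      using exp_le_2[OF \<theta>] by (intro mult_left_mono) auto
    finally show ?thesis using True by simp
  next
    case False
    then have "?L \<subseteq> {j\<in>{1..n}. put n a b x i j = v}" using i by (auto simp: put_def)
    then have "level n v x \<le> level n v (put n a b x i)"
      unfolding level_def by (intro card_mono) auto
    then have "exp (- \<theta> * real (level n v (put n a b x i))) \<le> ?e"
      using \<theta> by (simp add: mult_left_mono)
    then show ?thesis by (simp only: False if_False add_0_right mult_1_right)
  qed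
  have "(\<Sum>i=1..n. q i * exp (- \<theta> * real (level n v (put n a b x i))))
      \<le> (\<Sum>i=1..n. q i * (?e * (1 + (if i \<in> ?L then 2 * \<theta> else 0))))"
    using q one by (intro sum_mono mult_left_mono) (auto simp: admissible_def)
  also have "\<dots> = ?e * ((\<Sum>i=1..n. q i) + 2 * \<theta> * (\<Sum>i=1..n. if i \<in> ?L then q i else 0))"
    unfolding sum_distrib_left sum.distrib[symmetric] by (intro sum.cong) (auto simp: algebra_simps)
  also have "(\<Sum>i=1..n. if i \<in> ?L then q i else 0) = (\<Sum>i\<in>?L. q i)"
    by (rule sum.mono_neutral_cong_right) auto
  also have "(\<Sum>i=1..n. q i) = 1" using q by (simp add: admissible_def)
  also have "?e * (1 + 2 * \<theta> * (\<Sum>i\<in>?L. q i)) \<le> ?e * (1 + 2 * \<theta> * (real (level n v x) * (real k1 / real n)))"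
  proof -
    have "(\<Sum>i\<in>?L. q i) \<le> real (card ?L) * (real k1 / real n)"
      using q Lover by (intro sum_bounded_above) (auto simp: admissible_def)
    then show ?thesis using \<theta> by (intro mult_left_mono add_left_mono) (auto simp: level_def)
  qed
  also have "\<dots> \<le> ?e * exp (2 * \<theta> * (real (level n v x) * (real k1 / real n)))"
    by (intro mult_left_mono exp_ge_add_one_self) auto
  also have "\<dots> = exp (- \<theta> * real (level n v x) * (1 - 2 * real k1 / real n))"
    unfolding exp_add[symmetric] by (simp add: algebra_simps)
  finally show ?thesis .
qed

text \<open>The cap at \<open>v\<close> keeps every summand at most 1, which bounds the total by
  \<open>n\<close> and each increment by 1.\<close>

definition potential :: "nat \<Rightarrow> real \<Rightarrow> nat \<Rightarrow> (nat \<Rightarrow> nat) \<Rightarrow> real" where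
  "potential n \<rho> v x = (\<Sum>j=1..n. \<rho> ^ min (x j) v / \<rho> ^ v)"

lemma potential_le:
  assumes "1 \<le> \<rho>" shows "potential n \<rho> v x \<le> real n"
proof -
  have "\<rho> ^ min (x j) v / \<rho> ^ v \<le> 1" for j
    using assms by (simp add: power_increasing)
  then show ?thesis
    unfolding potential_def
    using sum_bounded_above[of "{1..n}" "\<lambda>j. \<rho> ^ min (x j) v / \<rho> ^ v" 1] by simp
qed

lemma potential_put:
  assumes "i \<in> {1..n}"
  shows "potential n \<rho> v (put n a b x i) =
    potential n \<rho> v x + (\<rho> ^ min (put n a b x i i) v / \<rho> ^ v - \<rho> ^ min (x i) v / \<rho> ^ v)"
proof -
  have "potential n \<rho> v (put n a b x i) = (\<Sum>j=1..n. \<rho> ^ min (x j) v / \<rho> ^ v +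
      (if j = i then \<rho> ^ min (put n a b x i i) v / \<rho> ^ v - \<rho> ^ min (x i) v / \<rho> ^ v else 0))"
    unfolding potential_def by (intro sum.cong) (auto simp: put_def)
  then show ?thesis using assms by (simp add: sum.distrib potential_def)
qed

lemma potential_mono:
  assumes "1 \<le> \<rho>" "i \<in> {1..n}"
  shows "potential n \<rho> v x \<le> potential n \<rho> v (put n a b x i)"
proof -
  have "\<rho> ^ min (x i) v / \<rho> ^ v \<le> \<rho> ^ min (put n a b x i i) v / \<rho> ^ v"
    using assms put_ge[of x i n a b i]
    by (intro divide_right_mono power_increasing) auto
  then show ?thesis using assms by (simp add: potential_put)
qed

text \<open>By \<open>low\<close> the overloaded bins carry at most half of the potential. Each
  remaining bin is hit with probability at least \<open>k2 / n\<close>, and the hit multiplies its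
  summand by at least \<open>\<rho>\<close>. Another half is lost in
  \<open>exp_minus_le_half\<close>, whence the divisor 4.\<close>

lemma potential_step:
  fixes \<theta> \<rho> :: real
  assumes n: "1 \<le> n" and q: "admissible n k1 k2 x q" and v: "mean n x \<le> real v"
    and \<theta>: "0 \<le> \<theta>" "\<theta> \<le> 1" and \<rho>: "1 \<le> \<rho>" and a: "1 \<le> a" and k2: "0 \<le> k2"
    and low: "2 * real (card (over n x)) \<le> potential n \<rho> v x"
  shows "(\<Sum>i=1..n. q i * exp (- \<theta> * potential n \<rho> v (put n a b x i)))
    \<le> exp (- \<theta> * potential n \<rho> v x * (1 + k2 * (\<rho> - 1) / 4 / real n))"
proof -
  let ?P = "potential n \<rho> v"
  let ?g = "\<lambda>j. \<rho> ^ min (x j) v / \<rho> ^ v"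
  let ?U = "{1..n} - over n x"
  let ?e = "exp (- \<theta> * ?P x)"
  have g: "0 \<le> ?g j" "?g j \<le> 1" for j
    using \<rho> by (auto simp: power_increasing)
  have one: "exp (- \<theta> * ?P (put n a b x i)) \<le> ?e * (1 - (if i \<in> ?U then \<theta> / 2 * ((\<rho> - 1) * ?g i) else 0))"
    if i: "i \<in> {1..n}" for i
  proof (cases "i \<in> ?U")
    case True
    define z where "z = \<rho> ^ min (put n a b x i i) v / \<rho> ^ v - ?g i"
    have P: "?P (put n a b x i) = ?P x + z" using i by (simp add: potential_put z_def)
    have xi: "real (x i) < mean n x" using True by (auto simp: over_def)
    \<comment> \<open>The strict inequality ensures that the cap does not swallow the first new
      ball.\<close>
    then have "x i < v" using v by linarith
    then have "Suc (min (x i) v) \<le> min (put n a b x i i) v" using xi a by (auto simp: put_def)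
    then have "\<rho> ^ Suc (min (x i) v) / \<rho> ^ v \<le> \<rho> ^ min (put n a b x i i) v / \<rho> ^ v"
      using \<rho> by (intro divide_right_mono power_increasing) auto
    then have z: "(\<rho> - 1) * ?g i \<le> z" by (simp add: z_def left_diff_distrib diff_divide_distrib)
    have "\<rho> ^ min (put n a b x i i) v / \<rho> ^ v \<le> 1" using \<rho> by (simp add: power_increasing)
    then have z1: "z \<le> 1" using g[of i] by (simp add: z_def)
    have "0 \<le> (\<rho> - 1) * ?g i" using \<rho> g[of i] by (intro mult_nonneg_nonneg) auto
    then have z0: "0 \<le> z" using z by linarith
    have "exp (- \<theta> * ?P (put n a b x i)) = ?e * exp (- (\<theta> * z))"
      unfolding P exp_add[symmetric] by (simp add: algebra_simps)
    also have "\<dots> \<le> ?e * (1 - \<theta> * z / 2)"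
      using \<theta> z0 z1 by (intro mult_left_mono exp_minus_le_half) (auto simp: mult_le_one)
    also have "\<dots> \<le> ?e * (1 - \<theta> / 2 * ((\<rho> - 1) * ?g i))"
      using mult_left_mono[OF z, of "\<theta> / 2"] \<theta> by (intro mult_left_mono) auto
    finally show ?thesis using True by simp
  next
    case False
    have "exp (- \<theta> * ?P (put n a b x i)) \<le> ?e"
      using potential_mono[OF \<rho> i, of v x a b] \<theta> by (simp add: mult_left_mono)
    then show ?thesis by (simp only: False if_False diff_zero mult_1_right)
  qed
  have "(\<Sum>i=1..n. q i * exp (- \<theta> * ?P (put n a b x i)))
      \<le> (\<Sum>i=1..n. q i * (?e * (1 - (if i \<in> ?U then \<theta> / 2 * ((\<rho> - 1) * ?g i) else 0))))"
    using q one by (intro sum_mono mult_left_mono) (auto simp: admissible_def)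
  also have "\<dots> = ?e * ((\<Sum>i=1..n. q i) - \<theta> / 2 * (\<rho> - 1) * (\<Sum>i=1..n. if i \<in> ?U then q i * ?g i else 0))"
    unfolding sum_distrib_left sum_subtractf[symmetric]
    by (intro sum.cong) (auto simp: algebra_simps diff_divide_distrib)
  also have "(\<Sum>i=1..n. if i \<in> ?U then q i * ?g i else 0) = (\<Sum>i\<in>?U. q i * ?g i)"
    by (rule sum.mono_neutral_cong_right) auto
  also have "(\<Sum>i=1..n. q i) = 1" using q by (simp add: admissible_def)
  also have "?e * (1 - \<theta> / 2 * (\<rho> - 1) * (\<Sum>i\<in>?U. q i * ?g i)) \<le>
      ?e * (1 - \<theta> / 2 * (\<rho> - 1) * (k2 / real n * (?P x / 2)))"
  proof -
    have "?P x = (\<Sum>i\<in>?U. ?g i) + (\<Sum>i\<in>over n x. ?g i)"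
      unfolding potential_def by (rule sum.subset_diff) (auto simp: over_def)
    moreover have "(\<Sum>i\<in>over n x. ?g i) \<le> real (card (over n x)) * 1"
      using g by (intro sum_bounded_above) auto
    ultimately have "?P x / 2 \<le> (\<Sum>i\<in>?U. ?g i)" using low by linarith
    then have "k2 / real n * (?P x / 2) \<le> k2 / real n * (\<Sum>i\<in>?U. ?g i)"
      using k2 by (intro mult_left_mono) auto
    also have "\<dots> \<le> (\<Sum>i\<in>?U. q i * ?g i)"
      unfolding sum_distrib_left using q g by (intro sum_mono mult_right_mono) (auto simp: admissible_def)
    finally have *: "k2 / real n * (?P x / 2) \<le> (\<Sum>i\<in>?U. q i * ?g i)" .
    show ?thesis
      using \<theta> \<rho> by (intro mult_left_mono diff_left_mono *) auto
  qed
  also have "\<dots> \<le> ?e * exp (- (\<theta> / 2 * (\<rho> - 1) * (k2 / real n * (?P x / 2))))"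
    using exp_ge_add_one_self[of "- (\<theta> / 2 * (\<rho> - 1) * (k2 / real n * (?P x / 2)))"]
    by (intro mult_left_mono) auto
  also have "\<dots> = exp (- \<theta> * ?P x * (1 + k2 * (\<rho> - 1) / 4 / real n))"
    unfolding exp_add[symmetric] by (simp add: field_simps)
  finally show ?thesis .
qed

section \<open>From one step to runs of many rounds\<close>

context allocation begin

lemma admissible_atom:
  assumes "prob (atom h) > 0"
  shows "admissible n k1 k2 (ld h) (\<lambda>i. prob (atom (i # h)) / prob (atom h))"
proof -
  have "(\<Sum>i=1..n. prob (atom (i # h))) = prob (atom h)"
  proof -
    have "g \<inter> space (sample A) = g" if "g = atom h'" for g h' using that by (auto simp: atom_def)
    then show ?thesis using prob_atom_split[of "space (sample A)" h] by simp
  qed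
  moreover have "prob (atom (i # h)) / prob (atom h) \<le> real k1 / real n" if "i \<in> over n (ld h)" for i
    using that prob_atom_Cons(1)[of i h] assms by (simp add: over_def pos_divide_le_eq)
  moreover have "k2 / real n \<le> prob (atom (i # h)) / prob (atom h)" if "i \<in> {1..n} - over n (ld h)" for i
    using that prob_atom_Cons(2)[of i h] assms by (auto simp: over_def pos_le_divide_eq not_le)
  ultimately show ?thesis
    using assms by (simp add: admissible_def sum_divide_distrib[symmetric])
qed

lemma events_run:
  "{\<omega>\<in>space (sample A). \<forall>s\<in>{m..m + r}. P (hist A s \<omega>)} \<in> events"
proof -
  have "{\<omega>\<in>space (sample A). \<forall>s\<in>{m..m + r}. P (hist A s \<omega>)}
      = (\<Inter>s\<in>{m..m + r}. {\<omega>\<in>space (sample A). P (hist A s \<omega>)})"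
  proof -
    have "m \<in> {m..m + r}" by simp
    then show ?thesis by blast
  qed
  also have "\<dots> \<in> events" by (intro sets.finite_INT events_hist) auto
  finally show ?thesis .
qed

text \<open>Here \<open>M\<close> is a supermartingale along the states in \<open>bad\<close> with \<open>r\<close> rounds to go; optional
  stopping is replaced by induction on \<open>r\<close> over the atoms of the histories.\<close>

lemma survival:
  fixes M :: "nat \<Rightarrow> (nat \<Rightarrow> nat) \<Rightarrow> real" and Inv :: "nat \<Rightarrow> (nat \<Rightarrow> nat) \<Rightarrow> bool"
  assumes nonneg: "\<And>r x. 0 \<le> M r x"
    and inv: "\<And>r x i. Inv (Suc r) x \<Longrightarrow> bad x \<Longrightarrow> i \<in> {1..n} \<Longrightarrow> Inv r (step x i)"
    and super: "\<And>r x q. r < R \<Longrightarrow> Inv (Suc r) x \<Longrightarrow> bad x \<Longrightarrow> admissible n k1 k2 x q \<Longrightarrow> M (Suc r) x < 1 \<Longrightarrow>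
      (\<Sum>i=1..n. q i * M r (step x i)) \<le> M (Suc r) x"
    and final: "\<And>x. Inv 0 x \<Longrightarrow> bad x \<Longrightarrow> 1 \<le> M 0 x"
  shows "r \<le> R \<Longrightarrow> Inv r (ld h) \<Longrightarrow>
    prob (atom h \<inter> {\<omega>\<in>space (sample A). \<forall>s\<in>{length h..length h + r}. bad (ld (hist A s \<omega>))})
      \<le> M r (ld h) * prob (atom h)"
proof (induction r arbitrary: h)
  case (0 h)
  let ?X = "{\<omega>\<in>space (sample A). \<forall>s\<in>{length h..length h + 0}. bad (ld (hist A s \<omega>))}"
  show ?case
  proof (cases "bad (ld h)")
    case True
    have "prob (atom h \<inter> ?X) \<le> 1 * prob (atom h)"
      using atom_events by (auto intro: finite_measure_mono)
    also have "\<dots> \<le> M 0 (ld h) * prob (atom h)"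
      using final[OF 0(2) True] by (intro mult_right_mono) auto
    finally show ?thesis .
  next
    case False
    then have "atom h \<inter> ?X = {}" by (auto simp: atom_def)
    then show ?thesis using nonneg by simp
  qed
next
  case (Suc r h)
  let ?X = "\<lambda>m r. {\<omega>\<in>space (sample A). \<forall>s\<in>{m..m + r}. bad (ld (hist A s \<omega>))}"
  have X: "?X m r \<in> events" for m r by (rule events_run)
  show ?case
  \<comment> \<open>If \<open>M\<close> is at least 1 the claim is trivial. This is why
    \<open>super\<close> may assume \<open>M (Suc r) x < 1\<close>, which acts as a stopping
    rule.\<close>
  proof (cases "bad (ld h) \<and> M (Suc r) (ld h) < 1 \<and> prob (atom h) > 0")
    case True
    then have bad: "bad (ld h)" and M: "M (Suc r) (ld h) < 1" and pos: "prob (atom h) > 0" by auto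
    have "prob (atom h \<inter> ?X (length h) (Suc r)) \<le> prob (atom h \<inter> ?X (Suc (length h)) r)"
      using atom_events X[of "Suc (length h)" r] by (intro finite_measure_mono sets.Int) auto
    also have "\<dots> = (\<Sum>i=1..n. prob (atom (i # h) \<inter> ?X (length (i # h)) r))"
      using prob_atom_split[OF X[of "Suc (length h)" r], of h] by simp
    also have "\<dots> \<le> (\<Sum>i=1..n. M r (ld (i # h)) * prob (atom (i # h)))"
      using Suc.prems inv[OF _ bad] by (intro sum_mono Suc.IH) auto
    also have "\<dots> = (\<Sum>i=1..n. prob (atom (i # h)) / prob (atom h) * M r (step (ld h) i)) * prob (atom h)"
      using pos unfolding sum_distrib_right by (intro sum.cong) auto
    also have "\<dots> \<le> M (Suc r) (ld h) * prob (atom h)"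
      using Suc.prems by (intro mult_right_mono super admissible_atom pos bad M) auto
    finally show ?thesis .
  next
    case False
    have le: "prob (atom h \<inter> ?X (length h) (Suc r)) \<le> prob (atom h)"
      using atom_events by (auto intro: finite_measure_mono)
    consider "\<not> bad (ld h)" | "M (Suc r) (ld h) \<ge> 1" | "\<not> 0 < prob (atom h)"
      using False by (meson not_le)
    then show ?thesis
    proof cases
      case 1
      then have "atom h \<inter> ?X (length h) (Suc r) = {}"
        by (auto simp: atom_def dest!: bspec[of _ _ "length h"])
      then show ?thesis using nonneg by simp
    next
      case 2
      have "1 * prob (atom h) \<le> M (Suc r) (ld h) * prob (atom h)"
        using 2 by (intro mult_right_mono) auto
      then show ?thesis using le by linarith
    next
      case 3
      then have "prob (atom h) = 0" using measure_nonneg[of "sample A" "atom h"] by linarith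
      then show ?thesis using le by simp
    qed
  qed
qed

text \<open>Total probability over the next \<open>k\<close> allocations: it lets an estimate valid
  after every continuation start at a later round.\<close>

lemma prob_atom_extend:
  assumes X: "X \<in> events"
    and bound: "\<And>g. set g \<subseteq> {1..n} \<Longrightarrow> length g = k \<Longrightarrow>
      prob (atom (g @ h) \<inter> X) \<le> c * prob (atom (g @ h))"
  shows "prob (atom h \<inter> X) \<le> c * prob (atom h)"
  using bound
proof (induction k arbitrary: h)
  case 0
  then show ?case using "0"[of "[]"] by simp
next
  case (Suc k h)
  have "prob (atom (i # h) \<inter> X) \<le> c * prob (atom (i # h))" if i: "i \<in> {1..n}" for i
  proof (rule Suc.IH)
    fix g assume "set g \<subseteq> {1..n}" "length g = k"
    then show "prob (atom (g @ i # h) \<inter> X) \<le> c * prob (atom (g @ i # h))"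
      using Suc.prems[of "g @ [i]"] i by simp
  qed
  then have "prob (atom h \<inter> X) \<le> (\<Sum>i=1..n. c * prob (atom (i # h) \<inter> space (sample A)))"
    unfolding prob_atom_split[OF X, of h]
    by (intro sum_mono) (simp add: atom_def Int_absorb2)
  also have "\<dots> = c * prob (atom h \<inter> space (sample A))"
    using prob_atom_split[OF sets.top, of h] by (simp add: sum_distrib_left)
  finally show ?case by (simp add: atom_def Int_absorb2)
qed

lemma spread_extend:
  assumes "set g \<subseteq> {1..n}"
  shows "spread n (ld (g @ h)) \<le> spread n (ld h) + 2 * real wminus * real (length g)"
  using assms
proof (induction g)
  case (Cons i g)
  then have "spread n (ld (i # g @ h)) \<le> spread n (ld (g @ h)) + 2 * real wminus"
    using wplus_le by (auto intro: spread_put)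
  then show ?case using Cons by (simp add: algebra_simps)
qed simp

end

section \<open>Runs that stay high and runs that stay low\<close>

lemma mean_nonneg: "0 \<le> mean n x"
  by (simp add: mean_def del: of_nat_sum)

lemma mean_put:
  assumes "i \<in> {1..n}"
  shows "mean n (put n a b x i) = mean n x + real (if real (x i) < mean n x then a else b) / real n"
  unfolding mean_def using sum_put[OF assms, of a b x] by (simp add: mean_def add_divide_distrib)

text \<open>At least half of the bins are within \<open>2 * C\<close> of the mean and more than
  three quarters are overloaded, so more than a quarter are both. Their loads take at most
  \<open>2 * C\<close> integer values, and one value is shared by at least the average
  number.\<close>

lemma exists_level:
  fixes C :: nat and \<epsilon> :: real
  assumes n: "1 \<le> n" and C: "1 \<le> C" and s: "spread n x \<le> real C * real n"
    and \<epsilon>: "\<epsilon> \<le> 1 / 8" and high: "(1 - 2 * \<epsilon>) * real n < real (card (over n x))"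
  shows "\<exists>v. real v < mean n x + 2 * real C \<and> real n / (8 * real C) \<le> real (level n v x)"
proof (rule ccontr)
  assume no: "\<not> ?thesis"
  let ?N = "{j\<in>{1..n}. \<bar>real (x j) - mean n x\<bar> < 2 * real C}"
  define S where "S = ?N \<inter> over n x"
  define v0 where "v0 = nat \<lceil>mean n x\<rceil>"
  have m0: "0 \<le> mean n x" by (rule mean_nonneg)
  have V: "x j \<in> {v0..<v0 + 2 * C} \<and> real (x j) < mean n x + 2 * real C" if "j \<in> S" for j
  proof -
    have x: "mean n x \<le> real (x j)" "real (x j) < mean n x + 2 * real C"
      using that by (auto simp: S_def over_def)
    moreover have "mean n x \<le> real v0" using m0 by (simp add: v0_def)
    then have "real (x j) < real (v0 + 2 * C)" using x by simp
    ultimately show ?thesis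
      by (simp only: of_nat_less_iff) (simp add: v0_def nat_le_iff ceiling_le_iff)
  qed
  let ?V = "{v\<in>{v0..<v0 + 2 * C}. real v < mean n x + 2 * real C}"
  have "card S \<le> card (\<Union>v\<in>?V. {j\<in>{1..n}. x j = v})"
    using V by (intro card_mono) (auto simp: S_def)
  also have "\<dots> \<le> (\<Sum>v\<in>?V. level n v x)"
    unfolding level_def by (rule card_UN_le) auto
  finally have S_le: "real (card S) \<le> (\<Sum>v\<in>?V. real (level n v x))"
    by (simp only: of_nat_sum[symmetric] of_nat_le_iff)
  have near: "real n / 2 \<le> real (card ?N)"
    using card_near_mean[of n "real C" x] n C s by simp
  have "card (?N \<union> over n x) \<le> card {1..n}" by (rule card_mono) (auto simp: over_def)
  then have "real (card ?N) + real (card (over n x)) \<le> real n + real (card S)"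
    using card_Un_Int[of ?N "over n x"] by (simp add: S_def)
  moreover have "(1 - 2 * \<epsilon>) * real n \<ge> (3 / 4) * real n"
    using \<epsilon> by (intro mult_right_mono) auto
  ultimately have S_ge: "real n / 4 < real (card S)" using near high by linarith
  then have "S \<noteq> {}" using n by auto
  then have ne: "?V \<noteq> {}" using V by blast
  have "card ?V \<le> card {v0..<v0 + 2 * C}" by (rule card_mono) auto
  then have cV: "real (card ?V) \<le> 2 * real C" by simp
  have "(\<Sum>v\<in>?V. real (level n v x)) \<le> real (card ?V) * (real n / (8 * real C))"
    using no by (intro sum_bounded_above) force
  also have "\<dots> \<le> 2 * real C * (real n / (8 * real C))"
    using cV by (intro mult_right_mono) auto
  also have "\<dots> = real n / 4" using C by simp
  finally show False using S_le S_ge by linarith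
qed

lemma level_le_under:
  assumes "real v < mean n x"
  shows "level n v x + card (over n x) \<le> n"
proof -
  have "card ({j\<in>{1..n}. x j = v} \<union> over n x) = level n v x + card (over n x)"
    unfolding level_def using assms by (intro card_Un_disjoint) (auto simp: over_def)
  moreover have "card ({j\<in>{1..n}. x j = v} \<union> over n x) \<le> card {1..n}"
    by (rule card_mono) (auto simp: over_def)
  ultimately show ?thesis by simp
qed

text \<open>At least half of the bins are within \<open>2 * C\<close> of the mean, hence at most
  \<open>d\<close> below \<open>v\<close>, and each of them contributes at least
  \<open>1 / \<rho> ^ d\<close>.\<close>

lemma potential_start:
  assumes n: "1 \<le> n" and C: "0 < C" and s: "spread n x \<le> C * real n" and \<rho>: "1 \<le> \<rho>"
    and v: "real v \<le> mean n x + w + 1" and d: "w + 1 + 2 * C \<le> real d"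
  shows "real n / (2 * \<rho> ^ d) \<le> potential n \<rho> v x"
proof -
  let ?N = "{j\<in>{1..n}. \<bar>real (x j) - mean n x\<bar> < 2 * C}"
  have "real n / 2 * (1 / \<rho> ^ d) \<le> real (card ?N) * (1 / \<rho> ^ d)"
    using card_near_mean[of n C x] n C s \<rho> by (intro mult_right_mono) auto
  also have "\<dots> \<le> (\<Sum>j\<in>?N. \<rho> ^ min (x j) v / \<rho> ^ v)"
  proof (rule sum_bounded_below)
    fix j assume "j \<in> ?N"
    then have "real v < real (x j + d)" using v d by auto
    then have "v \<le> min (x j) v + d" by simp
    then have "\<rho> ^ v \<le> \<rho> ^ (min (x j) v + d)" using \<rho> by (rule power_increasing)
    then show "1 / \<rho> ^ d \<le> \<rho> ^ min (x j) v / \<rho> ^ v"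
      using \<rho> by (simp add: field_simps power_add)
  qed
  also have "\<dots> \<le> potential n \<rho> v x"
    unfolding potential_def using \<rho> by (intro sum_mono2) auto
  finally show ?thesis by simp
qed

lemma exp_diff_mult: "exp (a - b * c) = exp a * exp (- b * c)" for a b c :: real
  by (simp add: exp_add[symmetric])

context allocation begin

text \<open>If almost all bins stay overloaded, then about \<open>n / (8 C)\<close> of them share a level \<open>v\<close>, which
  the mean passes within \<open>2 C n\<close> rounds; until then each overloaded bin is hit at rate at most
  \<open>k1 / n\<close>, so linearly many bins are still at level \<open>v\<close> when they become underloaded.\<close>

lemma prob_stay_high:
  fixes C :: nat and \<epsilon> c :: real
  assumes C: "1 \<le> C" and s: "spread n (ld h) \<le> real C * real n"
    and \<epsilon>: "\<epsilon> \<le> 1 / 8" "2 * \<epsilon> \<le> c"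
    and c: "c = exp (- 8 * real k1 * real C) / (16 * real C)" and n: "4 * k1 \<le> n"
  shows "prob (atom h \<inter> {\<omega>\<in>space (sample A). \<forall>s\<in>{length h..length h + 2 * C * n}.
      (1 - 2 * \<epsilon>) * real n < real (card (over n (ld (hist A s \<omega>))))})
    \<le> exp (- c * real n) * prob (atom h)"
proof (cases "(1 - 2 * \<epsilon>) * real n < real (card (over n (ld h)))")
  case False
  then have "atom h \<inter> {\<omega>\<in>space (sample A). \<forall>s\<in>{length h..length h + 2 * C * n}.
      (1 - 2 * \<epsilon>) * real n < real (card (over n (ld (hist A s \<omega>))))} = {}"
    by (auto simp: atom_def dest!: bspec[of _ _ "length h"])
  then show ?thesis by simp
next
  case True
  let ?bad = "\<lambda>x. (1 - 2 * \<epsilon>) * real n < real (card (over n x))"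
  obtain v where v: "real v < mean n (ld h) + 2 * real C"
      and lv: "real n / (8 * real C) \<le> real (level n v (ld h))"
    using exists_level[OF n_pos C s \<epsilon>(1) True] by blast
  \<comment> \<open>The weight decays by the factor exp(-4 k1/n) per remaining round, which is at
    most the factor 1 - 2 k1/n in \<open>level_step\<close>.\<close>
  define M where "M r x = exp (c * real n - exp (- (4 * real k1 / real n) * real r) * real (level n v x))"
    for r :: nat and x
  define Inv where "Inv r x \<longleftrightarrow> real v - mean n x < real r / real n" for r :: nat and x
  have M1: "1 \<le> M r x" if "?bad x" "real v < mean n x" for r x
  proof -
    have "real (level n v x) + real (card (over n x)) \<le> real n"
      using level_le_under[OF that(2)] by linarith
    then have "real (level n v x) \<le> 2 * \<epsilon> * real n"
      using that(1) by (simp add: algebra_simps)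
    also have "\<dots> \<le> c * real n" using \<epsilon> by (intro mult_right_mono) auto
    finally have "real (level n v x) \<le> c * real n" .
    moreover have "exp (- (4 * real k1 / real n) * real r) * real (level n v x) \<le> 1 * real (level n v x)"
      by (intro mult_right_mono) auto
    ultimately show ?thesis by (simp add: M_def)
  qed
  have "prob (atom h \<inter> {\<omega>\<in>space (sample A). \<forall>s\<in>{length h..length h + 2 * C * n}. ?bad (ld (hist A s \<omega>))})
      \<le> M (2 * C * n) (ld h) * prob (atom h)"
  proof (rule survival[where Inv = Inv and R = "2 * C * n"])
    show "0 \<le> M r x" for r x by (simp add: M_def)
    show "Inv r (step x i)" if "Inv (Suc r) x" "?bad x" "i \<in> {1..n}" for r x i
    proof -
      have "1 / real n \<le> real (if real (x i) < mean n x then wminus else wplus) / real n"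
        using wplus_pos wplus_le by (intro divide_right_mono) auto
      then show ?thesis
        using that(1) unfolding Inv_def mean_put[OF that(3)] by (simp add: add_divide_distrib)
    qed
    show "(\<Sum>i = 1..n. q i * M r (step x i)) \<le> M (Suc r) x"
      if "Inv (Suc r) x" "?bad x" "admissible n k1 k2 x q" "M (Suc r) x < 1" for r x q
    proof -
      \<comment> \<open>A bad state with \<open>M < 1\<close> cannot have its mean above
        \<open>v\<close>; so the bins at level \<open>v\<close> are still overloaded, as
        \<open>level_step\<close> requires.\<close>
      have v: "mean n x \<le> real v" using M1[OF that(2), of "Suc r"] that(4) by linarith
      define \<theta> where "\<theta> = exp (- (4 * real k1 / real n) * real r)"
      have \<theta>: "0 \<le> \<theta>" "\<theta> \<le> 1" by (auto simp: \<theta>_def)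
      have "(\<Sum>i = 1..n. q i * M r (step x i)) =
          exp (c * real n) * (\<Sum>i=1..n. q i * exp (- \<theta> * real (level n v (step x i))))"
        unfolding sum_distrib_left M_def \<theta>_def[symmetric] exp_diff_mult
        by (simp only: mult.left_commute)
      also have "\<dots> \<le> exp (c * real n) * exp (- \<theta> * real (level n v x) * (1 - 2 * real k1 / real n))"
        by (intro mult_left_mono level_step[OF n_pos that(3) v \<theta>]) auto
      also have "\<dots> \<le> M (Suc r) x"
      proof -
        have "exp (- (4 * real k1 / real n)) \<le> 1 - (4 * real k1 / real n) / 2"
          using n n_pos by (intro exp_minus_le_half) auto
        then have "\<theta> * real (level n v x) * exp (- (4 * real k1 / real n)) \<le>
            \<theta> * real (level n v x) * (1 - 2 * real k1 / real n)"
          using \<theta> by (intro mult_left_mono) auto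
        moreover have "exp (- (4 * real k1 / real n) * real (Suc r)) = \<theta> * exp (- (4 * real k1 / real n))"
          unfolding \<theta>_def exp_add[symmetric] by (simp add: algebra_simps add_divide_distrib)
        ultimately show ?thesis
          unfolding M_def exp_add[symmetric] by (simp add: mult_ac)
      qed
      finally show ?thesis .
    qed
    show "1 \<le> M 0 x" if "Inv 0 x" "?bad x" for x
      using that by (intro M1) (auto simp: Inv_def)
    show "Inv (2 * C * n) (ld h)" using v n_pos by (simp add: Inv_def)
  qed simp
  also have "\<dots> \<le> exp (- c * real n) * prob (atom h)"
  proof (intro mult_right_mono)
    have e: "- (4 * real k1 / real n) * real (2 * C * n) = - 8 * real k1 * real C"
      using n_pos by simp
    \<comment> \<open>\<open>c\<close> is half of the starting weight times the guaranteed fraction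
      1/(8C) of bins at the level; the other half is left as the decay rate.\<close>
    have "2 * c * real n = exp (- 8 * real k1 * real C) * (real n / (8 * real C))"
      by (simp add: c)
    also have "\<dots> \<le> exp (- 8 * real k1 * real C) * real (level n v (ld h))"
      by (intro mult_left_mono lv) auto
    finally show "M (2 * C * n) (ld h) \<le> exp (- c * real n)" unfolding M_def e by simp
  qed auto
  finally show ?thesis .
qed

text \<open>Only the loads up to a level \<open>v\<close> above every mean of the next \<open>n\<close> rounds count in the
  potential. While most bins are underloaded, it grows geometrically, and it cannot exceed \<open>n\<close>.\<close>

lemma prob_stay_low:
  fixes C \<epsilon> \<rho> \<kappa> :: real
  assumes C: "0 < C" and s: "spread n (ld h) \<le> C * real n" and \<rho>: "1 \<le> \<rho>"
    and d: "real wminus + 1 + 2 * C \<le> real d" and \<epsilon>: "8 * \<epsilon> * \<rho> ^ d \<le> 1"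
    and \<kappa>: "\<kappa> = k2 * (\<rho> - 1) / 8" "exp (- \<kappa>) \<le> 1 / (4 * \<rho> ^ d)" and n: "\<kappa> \<le> real n"
  shows "prob (atom h \<inter> {\<omega>\<in>space (sample A). \<forall>s\<in>{length h..length h + n}.
      real (card (over n (ld (hist A s \<omega>)))) < 2 * \<epsilon> * real n})
    \<le> exp (- (real n / (4 * \<rho> ^ d))) * prob (atom h)"
proof -
  let ?bad = "\<lambda>x. real (card (over n x)) < 2 * \<epsilon> * real n"
  \<comment> \<open>Each round raises the mean by at most \<open>wminus / n\<close>, so it stays
    below \<open>v\<close> for \<open>n\<close> rounds.\<close>
  define v where "v = nat \<lceil>mean n (ld h) + real wminus\<rceil>"
  have m0: "0 \<le> mean n (ld h)" by (rule mean_nonneg)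
  have v: "mean n (ld h) + real wminus \<le> real v" "real v \<le> mean n (ld h) + real wminus + 1"
    unfolding v_def using m0 by (auto simp: of_nat_nat intro: ceiling_correct order.trans)
  have P0: "real n / (2 * \<rho> ^ d) \<le> potential n \<rho> v (ld h)"
    by (rule potential_start[OF n_pos C s \<rho> v(2) d])
  have \<kappa>0: "0 \<le> \<kappa>" using k2_pos \<rho> by (simp add: \<kappa>)
  \<comment> \<open>The weight falls from 1 with \<open>n\<close> rounds left to
    \<open>exp (- \<kappa>)\<close> with none left. Its ratio \<open>exp (\<kappa> / n)\<close> per
    round is at most 1 + 2\<kappa>/n, the growth factor in \<open>potential_step\<close>. At the end
    \<open>M\<close> is at least 1, as the potential is at most \<open>n\<close>.\<close>
  define M where "M r x = exp (exp (- \<kappa>) * real n - exp (- \<kappa> + \<kappa> / real n * real r) * potential n \<rho> v x)"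
    for r :: nat and x
  define Inv where "Inv r x \<longleftrightarrow> mean n x + real r * real wminus / real n \<le> real v \<and>
      real n / (2 * \<rho> ^ d) \<le> potential n \<rho> v x" for r :: nat and x
  have "prob (atom h \<inter> {\<omega>\<in>space (sample A). \<forall>s\<in>{length h..length h + n}. ?bad (ld (hist A s \<omega>))})
      \<le> M n (ld h) * prob (atom h)"
  proof (rule survival[where Inv = Inv and R = n])
    show "0 \<le> M r x" for r x by (simp add: M_def)
    show "Inv r (step x i)" if "Inv (Suc r) x" "?bad x" "i \<in> {1..n}" for r x i
    proof -
      have "real (if real (x i) < mean n x then wminus else wplus) / real n \<le> real wminus / real n"
        using wplus_pos wplus_le by (intro divide_right_mono) auto
      moreover have "potential n \<rho> v x \<le> potential n \<rho> v (step x i)"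
        by (rule potential_mono[OF \<rho> that(3)])
      ultimately show ?thesis
        using that(1) unfolding Inv_def mean_put[OF that(3)]
        by (simp add: add_divide_distrib distrib_right)
    qed
    show "(\<Sum>i = 1..n. q i * M r (step x i)) \<le> M (Suc r) x"
      if r: "r < n" and that: "Inv (Suc r) x" "?bad x" "admissible n k1 k2 x q" for r x q
    proof -
      have "0 \<le> real (Suc r) * real wminus / real n" by simp
      then have v: "mean n x \<le> real v" using that(1) unfolding Inv_def by linarith
      define \<theta> where "\<theta> = exp (- \<kappa> + \<kappa> / real n * real r)"
      have "\<kappa> / real n * real r \<le> \<kappa> / real n * real n"
        using r \<kappa>0 by (intro mult_left_mono) auto
      then have \<theta>: "0 \<le> \<theta>" "\<theta> \<le> 1" using n_pos by (auto simp: \<theta>_def)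
      have "8 * \<epsilon> \<le> 1 / \<rho> ^ d" using \<epsilon> \<rho> by (simp add: field_simps)
      from mult_right_mono[OF this, of "real n / 2"]
      have "4 * \<epsilon> * real n \<le> real n / (2 * \<rho> ^ d)" by simp
      then have low: "2 * real (card (over n x)) \<le> potential n \<rho> v x"
        using that(1,2) unfolding Inv_def by linarith
      have "(\<Sum>i = 1..n. q i * M r (step x i)) =
          exp (exp (- \<kappa>) * real n) * (\<Sum>i=1..n. q i * exp (- \<theta> * potential n \<rho> v (step x i)))"
        unfolding sum_distrib_left M_def \<theta>_def[symmetric] exp_diff_mult
        by (simp only: mult.left_commute)
      also have "\<dots> \<le> exp (exp (- \<kappa>) * real n) *
          exp (- \<theta> * potential n \<rho> v x * (1 + k2 * (\<rho> - 1) / 4 / real n))"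
        using k2_pos wplus_pos wplus_le
        by (intro mult_left_mono potential_step[OF n_pos that(3) v \<theta> \<rho> _ _ low]) auto
      also have "\<dots> \<le> M (Suc r) x"
      proof -
        have "exp (\<kappa> / real n) \<le> 1 + 2 * (\<kappa> / real n)"
          using n n_pos \<kappa>0 by (intro exp_le_2) auto
        also have "\<dots> = 1 + k2 * (\<rho> - 1) / 4 / real n" by (simp add: \<kappa>)
        finally have "\<theta> * potential n \<rho> v x * exp (\<kappa> / real n) \<le>
            \<theta> * potential n \<rho> v x * (1 + k2 * (\<rho> - 1) / 4 / real n)"
          using \<theta> \<rho> by (intro mult_left_mono mult_nonneg_nonneg) (auto simp: potential_def intro!: sum_nonneg)
        moreover have "exp (- \<kappa> + \<kappa> / real n * real (Suc r)) = \<theta> * exp (\<kappa> / real n)"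
          unfolding \<theta>_def exp_add[symmetric] by (simp add: algebra_simps add_divide_distrib)
        ultimately show ?thesis
          unfolding M_def exp_add[symmetric] by (simp add: mult_ac)
      qed
      finally show ?thesis .
    qed
    show "1 \<le> M 0 x" if "Inv 0 x" "?bad x" for x
      using potential_le[OF \<rho>, of n v x] by (simp add: M_def)
    show "Inv n (ld h)" using v P0 n_pos by (simp add: Inv_def)
  qed simp
  also have "\<dots> \<le> exp (- (real n / (4 * \<rho> ^ d))) * prob (atom h)"
  proof (intro mult_right_mono)
    have "- \<kappa> + \<kappa> / real n * real n = 0" using n_pos by simp
    moreover have "exp (- \<kappa>) * real n \<le> 1 / (4 * \<rho> ^ d) * real n"
      using \<kappa> by (intro mult_right_mono) auto
    ultimately show "M n (ld h) \<le> exp (- (real n / (4 * \<rho> ^ d)))"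
      using P0 unfolding M_def by (simp add: field_simps)
  qed auto
  finally show ?thesis .
qed

end

section \<open>Deterministic count of balanced rounds\<close>

lemma rise_le:
  fixes c :: "nat \<Rightarrow> nat"
  assumes "\<And>t. c (Suc t) \<le> c t + 1" "s \<le> t"
  shows "real (c t) \<le> real (c s) + real (t - s)"
  using assms(2)
proof (induction t rule: dec_induct)
  case (step t)
  then show ?case using assms(1)[of t] by (simp add: of_nat_diff)
qed simp

text \<open>As \<open>c\<close> rises by at most one per round, leaving \<open>[0, n - 2 e]\<close> upwards, or rising from below
  \<open>e\<close> to \<open>2 e\<close>, takes at least \<open>e\<close> rounds with values in \<open>[e, n - e]\<close>.\<close>

lemma balanced_rounds:
  fixes c :: "nat \<Rightarrow> nat" and e :: real
  assumes inc: "\<And>t. c (Suc t) \<le> c t + 1" and e: "0 < e" "8 * e \<le> real n" and n: "2 \<le> n"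
    and t1: "t1 \<le> t0 + m" "t0 \<le> t1" "real (c t1) \<le> real n - 2 * e"
    and ex: "\<And>s. t0 \<le> s \<Longrightarrow> s \<le> t0 + m + n \<Longrightarrow> \<exists>t\<in>{s..s + n}. 2 * e \<le> real (c t)"
  shows "e \<le> real (card {t\<in>{t0..t0 + m + 2 * n}. e \<le> real (c t) \<and> real (c t) \<le> real n - e})"
proof -
  let ?G = "{t\<in>{t0..t0 + m + 2 * n}. e \<le> real (c t) \<and> real (c t) \<le> real n - e}"
  define k where "k = nat \<lceil>e\<rceil>"
  have k: "e \<le> real k" "real k < e + 1" using e by (auto simp: k_def) linarith
  have kn: "k \<le> n" using k e n by linarith
  have finish: "e \<le> real (card ?G)" if "S \<subseteq> ?G" "card S = k" for S
    using card_mono[of ?G S] that k by simp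
  show ?thesis
  \<comment> \<open>From at most \<open>n - 2 e\<close>, fewer than \<open>e\<close> unit rises
    cannot pass \<open>n - e\<close>. So the \<open>k\<close> rounds from \<open>t1\<close> on are
    balanced unless some value drops below \<open>e\<close>.\<close>
  proof (cases "\<forall>t\<in>{t1..<t1 + k}. e \<le> real (c t)")
    case True
    show ?thesis
    proof (rule finish)
      show "{t1..<t1 + k} \<subseteq> ?G"
      proof
        fix t assume t: "t \<in> {t1..<t1 + k}"
        then have "real (c t) \<le> real (c t1) + real (t - t1)"
          using t by (intro rise_le[of c, OF inc]) auto
        moreover have "real (t - t1) \<le> real k - 1" using t by auto
        ultimately show "t \<in> ?G" using t True t1 kn k by auto
      qed
    qed simp
  next
    case False
    then obtain s where s: "t1 \<le> s" "s < t1 + k" "real (c s) < e" by auto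
    then obtain t2 where t2: "s \<le> t2" "t2 \<le> s + n" "2 * e \<le> real (c t2)"
      using ex[of s] t1 kn by auto
    \<comment> \<open>The last round below \<open>e\<close> before \<open>t2\<close>: the climb from
      there to \<open>2 e\<close> takes at least \<open>k\<close> rounds, and during the first
      \<open>k\<close> of them the value is below 2e + 1, hence at most n - e.\<close>
    define t' where "t' = Max {t\<in>{s..t2}. real (c t) < e}"
    have fin: "finite {t\<in>{s..t2}. real (c t) < e}" by simp
    have "t' \<in> {t\<in>{s..t2}. real (c t) < e}"
      unfolding t'_def using s t2 by (intro Max_in) auto
    then have t': "s \<le> t'" "t' \<le> t2" "real (c t') < e" by auto
    have after: "e \<le> real (c t)" if "t' < t" "t \<le> t2" for t
    proof (rule ccontr)
      assume "\<not> ?thesis"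
      then have "t \<in> {t\<in>{s..t2}. real (c t) < e}" using that t' by auto
      then have "t \<le> t'" unfolding t'_def using fin by (rule Max_ge[rotated])
      then show False using that by simp
    qed
    have "real (c t2) \<le> real (c t') + real (t2 - t')"
      by (rule rise_le[of c, OF inc t'(2)])
    then have "e \<le> real (t2 - t')" using t2 t' by linarith
    then have k2: "t' + k \<le> t2" using t'(2) k(2) by linarith
    show ?thesis
    proof (rule finish)
      show "{t'<..t' + k} \<subseteq> ?G"
      proof
        fix t assume t: "t \<in> {t'<..t' + k}"
        then have "real (c t) \<le> real (c t') + real (t - t')"
          using t by (intro rise_le[of c, OF inc]) auto
        moreover have "real (t - t') \<le> real k" using t by auto
        moreover have "2 \<le> real n" using n by simp
        ultimately have "real (c t) \<le> real n - e" using t' k e by linarith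
        moreover have "e \<le> real (c t)" using t k2 by (intro after) auto
        moreover have "t \<in> {t0..t0 + m + 2 * n}" using t k2 t' s t1 t2 kn by auto
        ultimately show "t \<in> ?G" by simp
      qed
    qed simp
  qed
qed

section \<open>Union bound and choice of the constants\<close>

text \<open>\<open>d\<close> is fixed before \<open>\<rho>\<close>: the growth within
  \<open>n\<close> rounds is exponential in \<open>\<rho>\<close>, while the starting deficit is
  only a power of it.\<close>

lemma exists_growth_base:
  fixes \<alpha> :: real
  assumes "0 < \<alpha>"
  shows "\<exists>\<rho>\<ge>1. exp (- (\<alpha> * (\<rho> - 1))) \<le> 1 / (4 * \<rho> ^ d)"
proof -
  have "((\<lambda>\<rho>. exp (- (\<alpha> * (\<rho> - 1))) * (4 * \<rho> ^ d)) \<longlongrightarrow> 0) at_top"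
    using assms by real_asymp
  then have "\<forall>\<^sub>F \<rho> in at_top. exp (- (\<alpha> * (\<rho> - 1))) * (4 * \<rho> ^ d) < 1"
    by (rule order_tendstoD) simp
  then have "\<forall>\<^sub>F \<rho> in at_top. 1 \<le> \<rho> \<and> exp (- (\<alpha> * (\<rho> - 1))) * (4 * \<rho> ^ d) < 1"
    using eventually_ge_at_top[of 1] by eventually_elim auto
  then obtain \<rho> where "1 \<le> \<rho>" "exp (- (\<alpha> * (\<rho> - 1))) * (4 * \<rho> ^ d) < 1"
    by (auto simp: eventually_at_top_linorder)
  then show ?thesis by (intro exI[of _ \<rho>]) (auto simp: pos_le_divide_eq)
qed

context allocation begin

lemma cprob_ge:
  assumes E: "E \<in> events" and w: "\<omega> \<in> space (sample A)" and pos: "prob (atom (hist A t \<omega>)) > 0"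
    and fail: "prob (atom (hist A t \<omega>) - E) \<le> b * prob (atom (hist A t \<omega>))"
  shows "1 - b \<le> cprob A t E \<omega>"
proof -
  let ?a = "atom (hist A t \<omega>)"
  have "prob (?a - E) = prob ?a - prob (E \<inter> ?a)"
    using finite_measure_Diff'[OF atom_events E] by (simp add: Int_commute)
  then have "(1 - b) * prob ?a \<le> cprob A t E \<omega> * prob ?a"
    using cprob_atom[OF E w, of t] fail by (simp add: left_diff_distrib)
  then show ?thesis using pos by simp
qed

lemma delta_eq:
  "\<omega> \<in> space (sample A) \<Longrightarrow> delta n A t \<omega> = real (card (over n (ld (hist A t \<omega>)))) / real n"
  by (simp add: delta_def card_Bplus)

lemma prob_stay_low_later:
  fixes C \<epsilon> \<rho> \<kappa> :: real
  assumes C: "0 < C" and s: "spread n (ld h) + 2 * real wminus * real m \<le> C * real n" and \<rho>: "1 \<le> \<rho>"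
    and d: "real wminus + 1 + 2 * C \<le> real d" and \<epsilon>: "8 * \<epsilon> * \<rho> ^ d \<le> 1"
    and \<kappa>: "\<kappa> = k2 * (\<rho> - 1) / 8" "exp (- \<kappa>) \<le> 1 / (4 * \<rho> ^ d)" and n: "\<kappa> \<le> real n"
  shows "prob (atom h \<inter> {\<omega>\<in>space (sample A). \<forall>s\<in>{length h + m..length h + m + n}.
      real (card (over n (ld (hist A s \<omega>)))) < 2 * \<epsilon> * real n})
    \<le> exp (- (real n / (4 * \<rho> ^ d))) * prob (atom h)"
proof (rule prob_atom_extend[where k = m])
  fix g :: "nat list" assume g: "set g \<subseteq> {1..n}" "length g = m"
  have "spread n (ld (g @ h)) \<le> C * real n"
    using spread_extend[OF g(1), of h] g(2) s by simp
  from prob_stay_low[OF C this \<rho> d \<epsilon> \<kappa> n] g(2)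
  show "prob (atom (g @ h) \<inter> {\<omega>\<in>space (sample A). \<forall>s\<in>{length h + m..length h + m + n}.
      real (card (over n (ld (hist A s \<omega>)))) < 2 * \<epsilon> * real n})
    \<le> exp (- (real n / (4 * \<rho> ^ d))) * prob (atom (g @ h))"
    by (simp add: add.commute)
qed (rule events_run)

text \<open>In \<open>d\<close>, the term \<open>C + 2 * wminus * (2 * C + 1)\<close> bounds the
  spread divided by \<open>n\<close> at every round where a climb may have to start.\<close>

lemma prob_few_balanced:
  fixes C d K :: nat and \<epsilon> \<rho> \<kappa> c :: real
  assumes C: "1 \<le> C" and s: "spread n (ld h) \<le> real C * real n" and \<rho>: "1 \<le> \<rho>"
    and c: "c = exp (- 8 * real k1 * real C) / (16 * real C)"
    and d: "d = wminus + 1 + 2 * (C + 2 * wminus * (2 * C + 1))"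
    and \<kappa>: "\<kappa> = k2 * (\<rho> - 1) / 8" "exp (- \<kappa>) \<le> 1 / (4 * \<rho> ^ d)"
    and \<epsilon>: "0 < \<epsilon>" "\<epsilon> \<le> 1 / 8" "2 * \<epsilon> \<le> c" "8 * \<epsilon> * \<rho> ^ d \<le> 1" and K: "2 * C + 2 \<le> K"
    and n: "2 \<le> n" "4 * k1 \<le> n" "\<kappa> \<le> real n"
      "((2 * real C + 1) * real n + 2) * exp (- (\<epsilon> * real n)) \<le> 1"
  shows "prob (atom h - {\<omega>\<in>space (sample A). \<epsilon> * real n \<le>
      real (card {t\<in>{length h..length h + K * n}. delta n A t \<omega> \<in> {\<epsilon>..1 - \<epsilon>}})})
    \<le> exp (- (\<epsilon> * real n)) * prob (atom h)"
proof -
  let ?c = "\<lambda>\<omega> t. card (over n (ld (hist A t \<omega>)))"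
  let ?t0 = "length h"
  let ?e = "\<epsilon> * real n"
  let ?E = "{\<omega>\<in>space (sample A). ?e \<le>
      real (card {t\<in>{?t0..?t0 + K * n}. delta n A t \<omega> \<in> {\<epsilon>..1 - \<epsilon>}})}"
  define H where "H = {\<omega>\<in>space (sample A). \<forall>s\<in>{?t0..?t0 + 2 * C * n}.
      (1 - 2 * \<epsilon>) * real n < real (?c \<omega> s)}"
  define L where "L m = {\<omega>\<in>space (sample A). \<forall>s\<in>{?t0 + m..?t0 + m + n}.
      real (?c \<omega> s) < 2 * \<epsilon> * real n}" for m
  \<comment> \<open>A round with at most \<open>n - 2 * \<epsilon> * n\<close> overloaded bins comes
    within \<open>2 * C * n\<close> rounds, and the drop that starts a climb less than
    \<open>n\<close> rounds later.\<close>
  define N where "N = 2 * C * n + n"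
  have Hev: "H \<in> events" and Lev: "L m \<in> events" for m
    unfolding H_def L_def by (rule events_run)+
  have sub: "atom h - ?E \<subseteq> (atom h \<inter> H) \<union> (\<Union>m\<in>{..N}. atom h \<inter> L m)"
  proof
    fix \<omega> assume w: "\<omega> \<in> atom h - ?E"
    show "\<omega> \<in> (atom h \<inter> H) \<union> (\<Union>m\<in>{..N}. atom h \<inter> L m)"
    proof (rule ccontr)
      assume no: "\<omega> \<notin> (atom h \<inter> H) \<union> (\<Union>m\<in>{..N}. atom h \<inter> L m)"
      have ws: "\<omega> \<in> space (sample A)" using w by (simp add: atom_def)
      obtain t1 where t1: "?t0 \<le> t1" "t1 \<le> ?t0 + 2 * C * n" "real (?c \<omega> t1) \<le> real n - 2 * ?e"
        using no w ws by (auto simp: H_def not_less algebra_simps)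
      have "?e \<le> real (card {t\<in>{?t0..?t0 + 2 * C * n + 2 * n}. ?e \<le> real (?c \<omega> t) \<and>
          real (?c \<omega> t) \<le> real n - ?e})"
      proof (rule balanced_rounds[where c = "?c \<omega>", OF _ _ _ n(1) t1(2,1,3)])
        show "?c \<omega> (Suc t) \<le> ?c \<omega> t + 1" for t by (simp add: card_over_put[simplified])
        show "0 < ?e" using \<epsilon> n by simp
        show "8 * ?e \<le> real n" using mult_right_mono[OF \<epsilon>(2), of "real n"] by simp
        show "\<exists>t\<in>{s..s + n}. 2 * ?e \<le> real (?c \<omega> t)"
          if "?t0 \<le> s" "s \<le> ?t0 + 2 * C * n + n" for s
        proof -
          have "s - ?t0 \<le> N" using that by (simp add: N_def)
          then have "\<omega> \<notin> L (s - ?t0)" using no w by auto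
          then show ?thesis using ws that by (auto simp: L_def not_less mult.assoc)
        qed
      qed
      also have "\<dots> \<le> real (card {t\<in>{?t0..?t0 + K * n}. delta n A t \<omega> \<in> {\<epsilon>..1 - \<epsilon>}})"
      proof (intro of_nat_mono card_mono)
        have "(2 * C + 2) * n \<le> K * n" using K by (rule mult_le_mono1)
        moreover have "a / real n \<in> {\<epsilon>..1 - \<epsilon>} \<longleftrightarrow> ?e \<le> a \<and> a \<le> real n - ?e" for a
          using n by (simp add: pos_le_divide_eq pos_divide_le_eq left_diff_distrib)
        ultimately show "{t\<in>{?t0..?t0 + 2 * C * n + 2 * n}. ?e \<le> real (?c \<omega> t) \<and> real (?c \<omega> t) \<le> real n - ?e}
            \<subseteq> {t\<in>{?t0..?t0 + K * n}. delta n A t \<omega> \<in> {\<epsilon>..1 - \<epsilon>}}"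
          unfolding delta_eq[OF ws] by (auto simp only: mem_Collect_eq atLeastAtMost_iff) (auto simp: distrib_right)
      qed simp
      finally show False using w ws by simp
    qed
  qed
  have PH: "prob (atom h \<inter> H) \<le> exp (- c * real n) * prob (atom h)"
    unfolding H_def by (rule prob_stay_high[OF C s \<epsilon>(2,3) c n(2)])
  have PL: "prob (atom h \<inter> L m) \<le> exp (- (real n / (4 * \<rho> ^ d))) * prob (atom h)" if "m \<in> {..N}" for m
    unfolding L_def
  proof (rule prob_stay_low_later[OF _ _ \<rho> _ \<epsilon>(4) \<kappa> n(3), where C = "real (C + 2 * wminus * (2 * C + 1))"])
    show "0 < real (C + 2 * wminus * (2 * C + 1))" using C by (simp only: of_nat_0_less_iff)
    have "m \<le> (2 * C + 1) * n" using that by (simp add: N_def)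
    then have "real m \<le> real ((2 * C + 1) * n)" by (simp only: of_nat_le_iff)
    from mult_left_mono[OF this, of "2 * real wminus"]
    show "spread n (ld h) + 2 * real wminus * real m \<le> real (C + 2 * wminus * (2 * C + 1)) * real n"
      using s by (simp add: algebra_simps)
    show "real wminus + 1 + 2 * real (C + 2 * wminus * (2 * C + 1)) \<le> real d"
      unfolding d by simp
  qed
  \<comment> \<open>Each of the \<open>N + 2\<close> bad events has probability at most
    exp(-2\<epsilon>n) within the atom; one factor exp(-\<epsilon>n) pays for their number.\<close>
  have rate: "2 * \<epsilon> \<le> 1 / (4 * \<rho> ^ d)" using \<epsilon>(4) \<rho> by (simp add: field_simps)
  have "prob (atom h - ?E) \<le> prob ((atom h \<inter> H) \<union> (\<Union>m\<in>{..N}. atom h \<inter> L m))"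
    using sub by (rule finite_measure_mono) (auto intro!: sets.Un sets.finite_UN sets.Int atom_events Hev Lev)
  also have "\<dots> \<le> prob (atom h \<inter> H) + prob (\<Union>m\<in>{..N}. atom h \<inter> L m)"
    by (rule measure_Un_le) (auto intro!: sets.finite_UN sets.Int atom_events Hev Lev)
  also have "prob (\<Union>m\<in>{..N}. atom h \<inter> L m) \<le> (\<Sum>m\<in>{..N}. prob (atom h \<inter> L m))"
    by (rule measure_UNION_le) (auto intro!: sets.Int atom_events Lev)
  also have "\<dots> \<le> real (card {..N}) * (exp (- (real n / (4 * \<rho> ^ d))) * prob (atom h))"
    by (intro sum_bounded_above PL)
  also have "\<dots> \<le> real (card {..N}) * (exp (- (2 * \<epsilon> * real n)) * prob (atom h))"
    using mult_right_mono[OF rate, of "real n"] by (intro mult_left_mono mult_right_mono) auto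
  also have "prob (atom h \<inter> H) \<le> exp (- (2 * \<epsilon> * real n)) * prob (atom h)"
    using mult_right_mono[OF \<epsilon>(3), of "real n"]
    by (intro order.trans[OF PH] mult_right_mono) auto
  also have "exp (- (2 * \<epsilon> * real n)) * prob (atom h) +
      real (card {..N}) * (exp (- (2 * \<epsilon> * real n)) * prob (atom h))
      = ((2 * real C + 1) * real n + 2) * exp (- ?e) * (exp (- ?e) * prob (atom h))"
  proof -
    have "exp (- (2 * \<epsilon> * real n)) = exp (- ?e) * exp (- ?e)"
      unfolding exp_add[symmetric] by simp
    then show ?thesis by (simp add: N_def algebra_simps)
  qed
  also have "\<dots> \<le> 1 * (exp (- ?e) * prob (atom h))"
    by (intro mult_right_mono n(4)) auto
  finally show ?thesis by simp
qed

lemma events_few_balanced: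
  "{\<omega>\<in>space (sample A). b \<le> real (card {t\<in>{m..r}. delta n A t \<omega> \<in> S})} \<in> events"
proof -
  let ?G = "\<lambda>t. {\<omega>\<in>space (sample A). real (card (over n (ld (hist A t \<omega>)))) / real n \<in> S}"
  have G: "?G t \<in> events" for t by (rule events_hist)
  have "real (card {t\<in>{m..r}. delta n A t \<omega> \<in> S}) = (\<Sum>t\<in>{m..r}. indicat_real (?G t) \<omega>)"
    if "\<omega> \<in> space (sample A)" for \<omega>
    using that by (simp add: delta_eq indicator_def sum.If_cases Int_def)
  then have "{\<omega>\<in>space (sample A). b \<le> real (card {t\<in>{m..r}. delta n A t \<omega> \<in> S})} =
      {\<omega>\<in>space (sample A). b \<le> (\<Sum>t\<in>{m..r}. indicat_real (?G t) \<omega>)}"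
    by auto
  also have "\<dots> \<in> events"
    using G by (intro borel_measurable_le borel_measurable_sum borel_measurable_indicator) auto
  finally show ?thesis .
qed

end

theorem theorem5p1:
  fixes k1 wminus wplus C :: nat and k2 :: real
  assumes "1 \<le> k1" and "0 < k2" and "k2 \<le> 1"
    and "1 \<le> wplus" and "wplus \<le> wminus" and "1 \<le> C"
  shows "\<exists>\<epsilon>::real. 0 < \<epsilon> \<and> \<epsilon> < 1 / 2 \<and> 1 / (4 * \<epsilon>) \<in> \<int> \<and>
    (\<forall>A :: nat \<Rightarrow> 'a alloc.
      (\<forall>n\<ge>1. allocation_process n (A n) \<and> cond_P1 k1 k2 n (A n) \<and>
              cond_W1 wminus wplus n (A n)) \<longrightarrow>
      (\<forall>\<^sub>F n in sequentially. \<forall>t0. AE \<omega> in sample (A n).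
         Delta n (A n) t0 \<omega> \<le> real C * real n \<longrightarrow>
         cprob (A n) t0
           {\<omega>'\<in>space (sample (A n)).
              \<epsilon> * real n \<le> real (card {t. t0 \<le> t \<and> real t \<le> real t0 + real n / (4 * \<epsilon>) \<and>
                                      delta n (A n) t \<omega>' \<in> {\<epsilon>..1 - \<epsilon>}})} \<omega>
         \<ge> 1 - exp (- (\<epsilon> * real n))))"
proof -
  define c where "c = exp (- 8 * real k1 * real C) / (16 * real C)"
  define d where "d = wminus + 1 + 2 * (C + 2 * wminus * (2 * C + 1))"
  obtain \<rho> where \<rho>: "1 \<le> \<rho>" "exp (- (k2 / 8 * (\<rho> - 1))) \<le> 1 / (4 * \<rho> ^ d)"
    using exists_growth_base[of "k2 / 8" d] assms by auto
  define \<kappa> where "\<kappa> = k2 * (\<rho> - 1) / 8"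
  have \<kappa>: "exp (- \<kappa>) \<le> 1 / (4 * \<rho> ^ d)" using \<rho> by (simp add: \<kappa>_def)
  have c0: "0 < c" using assms by (simp add: c_def)
  \<comment> \<open>The three summands serve 2\<epsilon> \<le> \<open>c\<close>,
    8\<epsilon>\<open>\<rho> ^ d\<close> \<le> 1 and a window of at least (2C + 2)n rounds; an
    integer \<open>K\<close> makes 1/(4\<epsilon>) an integer.\<close>
  define K where "K = nat \<lceil>1 / (2 * c) + 2 * \<rho> ^ d\<rceil> + 2 * C + 2"
  have "1 / (2 * c) + 2 * \<rho> ^ d \<le> real (nat \<lceil>1 / (2 * c) + 2 * \<rho> ^ d\<rceil>)" by linarith
  moreover have "0 \<le> 2 * \<rho> ^ d" "0 \<le> 1 / (2 * c)" using \<rho> c0 by auto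
  moreover have "real K = real (nat \<lceil>1 / (2 * c) + 2 * \<rho> ^ d\<rceil>) + 2 * real C + 2"
    by (simp add: K_def)
  ultimately have K: "1 / (2 * c) \<le> real K" "2 * \<rho> ^ d \<le> real K"
    by linarith+
  have K2: "2 * C + 2 \<le> K" by (simp add: K_def)
  define \<epsilon> where "\<epsilon> = 1 / (4 * real K)"
  have \<epsilon>: "0 < \<epsilon>" "\<epsilon> \<le> 1 / 8" "2 * \<epsilon> \<le> c" "8 * \<epsilon> * \<rho> ^ d \<le> 1" "1 / (4 * \<epsilon>) = real K"
    using K K2 c0 by (auto simp: \<epsilon>_def field_simps)
  have "((\<lambda>n. ((2 * real C + 1) * real n + 2) * exp (- (\<epsilon> * real n))) \<longlongrightarrow> 0) sequentially"
    using \<epsilon>(1) by real_asymp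
  then have tail: "\<forall>\<^sub>F n in sequentially. ((2 * real C + 1) * real n + 2) * exp (- (\<epsilon> * real n)) < 1"
    by (rule order_tendstoD) simp
  have "\<forall>\<^sub>F n in sequentially. \<forall>t0. AE \<omega> in sample (A n).
         Delta n (A n) t0 \<omega> \<le> real C * real n \<longrightarrow>
         cprob (A n) t0
           {\<omega>'\<in>space (sample (A n)).
              \<epsilon> * real n \<le> real (card {t. t0 \<le> t \<and> real t \<le> real t0 + real n / (4 * \<epsilon>) \<and>
                                      delta n (A n) t \<omega>' \<in> {\<epsilon>..1 - \<epsilon>}})} \<omega>
         \<ge> 1 - exp (- (\<epsilon> * real n))"
    if A: "\<forall>n\<ge>1. allocation_process n (A n) \<and> cond_P1 k1 k2 n (A n) \<and> cond_W1 wminus wplus n (A n)"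
    for A :: "nat \<Rightarrow> 'a alloc"
    using tail eventually_ge_at_top[of 2] eventually_ge_at_top[of "4 * k1"]
      eventually_ge_at_top[of "nat \<lceil>\<kappa>\<rceil>"]
  proof (eventually_elim, intro allI)
    fix n t0 :: nat
    assume n: "((2 * real C + 1) * real n + 2) * exp (- (\<epsilon> * real n)) < 1"
      "2 \<le> n" "4 * k1 \<le> n" "nat \<lceil>\<kappa>\<rceil> \<le> n"
    have \<kappa>n: "\<kappa> \<le> real n" using n(4) by linarith
    interpret allocation n k1 wminus wplus k2 "A n"
      using assms A n by unfold_locales auto
    have window: "{t. t0 \<le> t \<and> real t \<le> real t0 + real n / (4 * \<epsilon>) \<and>
        delta n (A n) t \<omega> \<in> {\<epsilon>..1 - \<epsilon>}} =
        {t\<in>{t0..t0 + K * n}. delta n (A n) t \<omega> \<in> {\<epsilon>..1 - \<epsilon>}}" for \<omega>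
    proof -
      have "real n / (4 * \<epsilon>) = real n * (1 / (4 * \<epsilon>))" by simp
      then have "real n / (4 * \<epsilon>) = real (K * n)" unfolding \<epsilon>(5) by simp
      then have "real t \<le> real t0 + real n / (4 * \<epsilon>) \<longleftrightarrow> t \<le> t0 + K * n" for t
        by (simp only: of_nat_add[symmetric] of_nat_le_iff)
      then show ?thesis by auto
    qed
    show "AE \<omega> in sample (A n). Delta n (A n) t0 \<omega> \<le> real C * real n \<longrightarrow>
         cprob (A n) t0
           {\<omega>'\<in>space (sample (A n)).
              \<epsilon> * real n \<le> real (card {t. t0 \<le> t \<and> real t \<le> real t0 + real n / (4 * \<epsilon>) \<and>
                                      delta n (A n) t \<omega>' \<in> {\<epsilon>..1 - \<epsilon>}})} \<omega>
         \<ge> 1 - exp (- (\<epsilon> * real n))"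
      using AE_atom_pos[of t0] AE_space
    proof eventually_elim
      case (elim \<omega>)
      show ?case
      proof
        assume D: "Delta n (A n) t0 \<omega> \<le> real C * real n"
        then have s: "spread n (ld (hist (A n) t0 \<omega>)) \<le> real C * real n"
          using Delta_eq[OF elim(2)] by simp
        show "1 - exp (- (\<epsilon> * real n)) \<le> cprob (A n) t0
           {\<omega>'\<in>space (sample (A n)).
              \<epsilon> * real n \<le> real (card {t. t0 \<le> t \<and> real t \<le> real t0 + real n / (4 * \<epsilon>) \<and>
                                      delta n (A n) t \<omega>' \<in> {\<epsilon>..1 - \<epsilon>}})} \<omega>"
          unfolding window
          using prob_few_balanced[OF assms(6) s \<rho>(1) c_def d_def \<kappa>_def \<kappa> \<epsilon>(1-4) K2 n(2,3) \<kappa>n less_imp_le[OF n(1)]]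
          by (intro cprob_ge[OF events_few_balanced elim(2,1)]) simp
      qed
    qed
  qed
  then show ?thesis
    using \<epsilon> by (intro exI[of _ \<epsilon>] conjI allI impI) (auto simp: \<epsilon>(5))
qed

end
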